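(* (1) For $\mathcal{R} = \mathcal{R}_{\rm BL} \cup \mathcal{R}_{\rm NW} \cup \mathcal{R}_{\rm NE}$, $m_{\mathcal{R}}(k) \leq 5k-2$ for all $k$. (2) For $\mathcal{R} = \mathcal{R}_{\rm HS} \cup \mathcal{R}_{\rm VS} \cup \mathcal{R}_{\rm NW} \cup \mathcal{R}_{\rm NE} \cup \mathcal{R}_{\rm SW} \cup \mathcal{R}_{\rm SE}$, $m_{\mathcal{R}}(k) \leq 10k-1$ for all $k$. (3) For $\mathcal{R} = \mathcal{R}_{\rm HS} \cup \mathcal{R}_{\rm VS} \cup \mathcal{R}_{\rm DS} \cup \mathcal{R}_{\rm NW} \cup \mathcal{R}_{\rm SE}$, $m_{\mathcal{R}}(k) \leq \lceil 4k\ln k + k\ln 3 \rceil + 4k$ for all $k$.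
   Context: Range families (all parameters range over $\mathbb{R}$): north-west quadrants $\mathcal{R}_{\rm NW} = \{\{x \leq a, y \geq b\}\}$, north-east $\mathcal{R}_{\rm NE} = \{\{x \geq a, y \geq b\}\}$, south-west $\mathcal{R}_{\rm SW} = \{\{x \leq a, y \leq b\}\}$, south-east $\mathcal{R}_{\rm SE} = \{\{x \geq a, y \leq b\}\}$; horizontal strips $\mathcal{R}_{\rm HS} = \{\{b_1 \leq y \leq b_2\}\}$; vertical strips $\mathcal{R}_{\rm VS} = \{\{a_1 \leq x \leq a_2\}\}$; diagonal strips $\mathcal{R}_{\rm DS} = \{\{a \leq x+y \leq b\}\}$; bottomless rectangles $\mathcal{R}_{\rm BL} = \{\{a_1 \leq x \leq a_2, y \leq b\}\}$. For finite $V \subset \mathbb{R}^2$, $\mathcal{H}(V,\mathcal{R},m)$ is the hypergraph on $V$ whose hyperedges are the sets $V \cap R$, $R \in \mathcal{R}$, of size exactly $m$. A $k$-coloring is polychromatic if every hyperedge contains all $k$ colors. Point sets are in general position (pairwise distinct $x$-coordinates, $y$-coordinates and values $x+y$). $m_{\mathcal{R}}(k)$ is the smallest $m$ such that for every finite $V$ in general position $\mathcal{H}(V,\mathcal{R},m)$ admits a polychromatic $k$-coloring. *)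

theory Defs
  imports Complex_Main "HOL-Library.Extended_Nat"
begin

type_synonym point = "real \<times> real"

definition R_NW :: "point set set" where
  "R_NW = {{p. fst p \<le> a \<and> snd p \<ge> b} | a b. True}"
definition R_NE :: "point set set" where
  "R_NE = {{p. fst p \<ge> a \<and> snd p \<ge> b} | a b. True}"
definition R_SW :: "point set set" where
  "R_SW = {{p. fst p \<le> a \<and> snd p \<le> b} | a b. True}"
definition R_SE :: "point set set" where
  "R_SE = {{p. fst p \<ge> a \<and> snd p \<le> b} | a b. True}"
definition R_HS :: "point set set" where
  "R_HS = {{p. b1 \<le> snd p \<and> snd p \<le> b2} | b1 b2. True}"
definition R_VS :: "point set set" where
  "R_VS = {{p. a1 \<le> fst p \<and> fst p \<le> a2} | a1 a2. True}"
definition R_DS :: "point set set" where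
  "R_DS = {{p. a \<le> fst p + snd p \<and> fst p + snd p \<le> b} | a b. True}"
definition R_BL :: "point set set" where
  "R_BL = {{p. a1 \<le> fst p \<and> fst p \<le> a2 \<and> snd p \<le> b} | a1 a2 b. True}"

definition hyperedges :: "point set \<Rightarrow> point set set \<Rightarrow> nat \<Rightarrow> point set set" where
  "hyperedges V \<R> m = {V \<inter> R | R. R \<in> \<R> \<and> card (V \<inter> R) = m}"

definition polychromatic :: "nat \<Rightarrow> (point \<Rightarrow> nat) \<Rightarrow> point set set \<Rightarrow> bool" where
  "polychromatic k c E \<longleftrightarrow> (\<forall>e\<in>E. \<forall>i<k. \<exists>x\<in>e. c x = i)"

definition general_position :: "point set \<Rightarrow> bool" where
  "general_position V \<longleftrightarrow> inj_on fst V \<and> inj_on snd V \<and> inj_on (\<lambda>p. fst p + snd p) V"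

definition admits_poly :: "point set set \<Rightarrow> nat \<Rightarrow> nat \<Rightarrow> bool" where
  "admits_poly \<R> k m \<longleftrightarrow>
     (\<forall>V. finite V \<longrightarrow> general_position V \<longrightarrow>
        (\<exists>c. (\<forall>x\<in>V. c x < k) \<and> polychromatic k c (hyperedges V \<R> m)))"

text \<open>m_R(k): least m with the property (infinity if none exists).\<close>
definition m_R :: "point set set \<Rightarrow> nat \<Rightarrow> enat" where
  "m_R \<R> k = Inf {enat m | m. admits_poly \<R> k m}"

end

theory Submission
  imports Defs
begin

text \<open>
  Quadrants are handled first, on a partial colouring that leaves enough uncoloured points in all
  other ranges, and the remaining ranges are then coloured on the uncoloured points.

  For (2) and (3) the quadrants of one type are coloured by \<open>k\<close> successive hitting sets, each of which
  takes at most two points from a range of critical size. Four types cost \<open>8 k\<close> points and leave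
  \<open>2 k - 1\<close> for two strip directions, settled by an edge colouring of a bipartite graph; two types
  cost \<open>4 k\<close>. Three strip directions are cut into blocks of \<open>3 k\<close> points, and each block receives \<open>k\<close> private
  points by Hall's theorem. Hence \<open>6 k - 1\<close> points suffice, which is below the logarithmic bound for
  \<open>k \<ge> 3\<close>; for \<open>k = 2\<close> blocks of four points are coloured by a linear algebra argument.

  For (1) two sweeps, one from the left and one from the right, colour the two types of quadrants
  so that a bottomless rectangle loses at most \<open>k\<close> points to each, and \<open>3 k - 2\<close> points are enough for
  bottomless rectangles alone.
\<close>

section \<open>Colourings from matchings and linear algebra\<close>

text \<open>Quadrants come before the other ranges because a hitting set for one quadrant type can
  be chosen as a chain, and the other ranges contain whatever lies between two of their points in
  both coordinates; \<open>chain_convex\<close> records just this. A diagonal strip has this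
  property only for chains along which x + y is monotone, and these belong to north-west and
  south-east quadrants; hence (3) admits no other type. Bottomless rectangles are chain-convex too,
  so hitting sets would already give 3k - 2 + 4k = 7k - 2 in (1); the sweeps lower the cost of a
  quadrant type from 2k to k. Strip thresholds have the form 2s - 1, since 2s - 1 consecutive points
  contain a full block of s points; s is k for two directions and 3k for three. The latter is only
  just enough: for k = 3 the bound 15 ln 3, about 16.48, rounds up to 17 = 6 * 3 - 1. For k = 2 it
  rounds up to 8, which is below 11, and blocks of four points with threshold 7 must replace those
  of six.\<close>

lemma hall_marriage:
  assumes "finite I" "\<And>i. i \<in> I \<Longrightarrow> finite (A i)"
    and "\<And>J. J \<subseteq> I \<Longrightarrow> card J \<le> card (\<Union>(A ` J))"
  shows "\<exists>f. inj_on f I \<and> (\<forall>i\<in>I. f i \<in> A i)"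
  using assms
proof (induction "card I" arbitrary: I A rule: less_induct)
  case less
  have finU: "finite (\<Union>(A ` J))" if "J \<subseteq> I" for J
    using that less.prems finite_subset by blast
  show ?case
  proof (cases "I = {}")
    case False
    show ?thesis
    \<comment> \<open>Halmos and Vaughan: a tight proper subfamily is matched on its own, and the
      other sets keep Hall's condition outside its union. If none is tight, every other union can
      spare the element given to \<open>i\<close>.\<close>
    proof (cases "\<exists>J. J \<subset> I \<and> J \<noteq> {} \<and> card J = card (\<Union>(A ` J))")
      case True
      then obtain J where J: "J \<subset> I" "J \<noteq> {}" "card J = card (\<Union>(A ` J))" by blast
      define U where "U = \<Union>(A ` J)"
      have finJ: "finite J" using J(1) less.prems(1) finite_subset by blast
      have "card J < card I" using J(1) less.prems(1) by (simp add: psubset_card_mono)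
      then obtain f where f: "inj_on f J" "\<forall>i\<in>J. f i \<in> A i"
        using less.hyps[of J A] J(1) less.prems finJ by (metis psubset_imp_subset subset_eq subset_trans)
      have "card (I - J) < card I"
        using J less.prems(1) by (intro psubset_card_mono) auto
      moreover have "card K \<le> card (\<Union>((\<lambda>i. A i - U) ` K))" if K: "K \<subseteq> I - J" for K
      proof -
        have finK: "finite K" using K less.prems(1) finite_subset by blast
        have "card J + card K = card (J \<union> K)"
          using K finJ finK by (intro card_Un_disjoint[symmetric]) auto
        also have "\<dots> \<le> card (\<Union>(A ` (J \<union> K)))"
          using K J(1) by (intro less.prems(3)) auto
        also have "\<Union>(A ` (J \<union> K)) = U \<union> \<Union>((\<lambda>i. A i - U) ` K)" by (auto simp: U_def)
        also have "card \<dots> \<le> card U + card (\<Union>((\<lambda>i. A i - U) ` K))" by (rule card_Un_le)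
        finally show ?thesis using J(3) by (simp add: U_def)
      qed
      ultimately obtain g where g: "inj_on g (I - J)" "\<forall>i\<in>I - J. g i \<in> A i - U"
        using less.hyps[of "I - J" "\<lambda>i. A i - U"] less.prems(1,2) by auto
      have "inj_on (\<lambda>i. if i \<in> J then f i else g i) I"
      proof (rule inj_onI)
        fix i j assume ij: "i \<in> I" "j \<in> I"
          "(if i \<in> J then f i else g i) = (if j \<in> J then f j else g j)"
        have fU: "f l \<in> U" if "l \<in> J" for l using f(2) that by (auto simp: U_def)
        have gU: "g l \<notin> U" if "l \<in> I" "l \<notin> J" for l using g(2) that by auto
        show "i = j" using ij fU gU f(1) g(1)
          by (cases "i \<in> J"; cases "j \<in> J") (auto dest: inj_onD, metis+)
      qed
      moreover have "\<forall>i\<in>I. (if i \<in> J then f i else g i) \<in> A i" using f g by auto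
      ultimately show ?thesis by blast
    next
      case noJ: False
      obtain i where i: "i \<in> I" using False by blast
      have "card {i} \<le> card (\<Union>(A ` {i}))" using i by (intro less.prems(3)) auto
      then obtain a where a: "a \<in> A i" by fastforce
      have "card (I - {i}) < card I" using i less.prems(1) by (intro psubset_card_mono) auto
      moreover have "card K \<le> card (\<Union>((\<lambda>i. A i - {a}) ` K))" if K: "K \<subseteq> I - {i}" for K
      proof (cases "K = {}")
        case False
        have "K \<subset> I" "K \<subseteq> I" using K i by auto
        then have "card K < card (\<Union>(A ` K))"
          using noJ False less.prems(3)[of K] by (metis order_le_imp_less_or_eq)
        moreover have "\<Union>((\<lambda>i. A i - {a}) ` K) = \<Union>(A ` K) - {a}" by auto
        moreover have "card (\<Union>(A ` K)) - 1 \<le> card (\<Union>(A ` K) - {a})"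
          using diff_card_le_card_Diff[of "{a}" "\<Union>(A ` K)"] by simp
        ultimately show ?thesis by simp
      qed simp
      ultimately obtain f where f: "inj_on f (I - {i})" "\<forall>j\<in>I - {i}. f j \<in> A j - {a}"
        using less.hyps[of "I - {i}" "\<lambda>i. A i - {a}"] less.prems(1,2) by auto
      have "inj_on (f(i := a)) I" "\<forall>j\<in>I. (f(i := a)) j \<in> A j"
        using f a by (auto simp: inj_on_def)
      then show ?thesis by blast
    qed
  qed simp
qed

section \<open>Double counting and private vertices\<close>

lemma sum_card_eq_sum_degree:
  assumes "finite V" "finite \<E>" "\<And>e. e \<in> \<E> \<Longrightarrow> e \<subseteq> V"
  shows "(\<Sum>e\<in>\<E>. card e) = (\<Sum>v\<in>V. card {e \<in> \<E>. v \<in> e})"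
proof -
  have "(\<Sum>e\<in>\<E>. card {v \<in> V. v \<in> e}) = (\<Sum>v\<in>V. card {e \<in> \<E>. v \<in> e})"
    by (rule sum_multicount_gen) (use assms in auto)
  moreover have "{v \<in> V. v \<in> e} = e" if "e \<in> \<E>" for e using assms(3)[OF that] by auto
  ultimately show ?thesis by simp
qed

lemma card_edges_bound:
  assumes "finite V" "finite \<E>" "\<And>e. e \<in> \<E> \<Longrightarrow> e \<subseteq> V"
    and "\<And>e. e \<in> \<E> \<Longrightarrow> s \<le> card e" and "\<And>v. v \<in> V \<Longrightarrow> card {e \<in> \<E>. v \<in> e} \<le> d"
  shows "card \<E> * s \<le> card V * d"
proof -
  have "card \<E> * s \<le> (\<Sum>e\<in>\<E>. card e)" using sum_bounded_below[of \<E> s card] assms(4) by simp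
  also have "\<dots> = (\<Sum>v\<in>V. card {e \<in> \<E>. v \<in> e})"
    using assms by (intro sum_card_eq_sum_degree)
  also have "\<dots> \<le> card V * d" using sum_bounded_above[of V _ d] assms(5) by simp
  finally show ?thesis .
qed

text \<open>Hall's theorem hands every edge \<open>k\<close> private vertices.\<close>

lemma polychromatic_of_bounded_degree:
  fixes \<E> :: "'a set set"
  assumes "finite \<E>" "\<And>e. e \<in> \<E> \<Longrightarrow> finite e" "\<And>e. e \<in> \<E> \<Longrightarrow> d * k \<le> card e"
    and "\<And>v. card {e \<in> \<E>. v \<in> e} \<le> d" and "0 < d" "0 < k"
  shows "\<exists>c. (\<forall>v. c v < k) \<and> (\<forall>e\<in>\<E>. {..<k} \<subseteq> c ` e)"
proof -
  \<comment> \<open>One index for each pair of an edge and a colour. Since edges have at least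
    \<open>d * k\<close> vertices and degrees are at most \<open>d\<close>, any family of edges
    covers at least \<open>k\<close> vertices per edge, which is Hall's condition for
    \<open>I\<close>.\<close>
  define I where "I = \<E> \<times> {..<k}"
  have "\<exists>f. inj_on f I \<and> (\<forall>i\<in>I. f i \<in> fst i)"
  proof (rule hall_marriage)
    fix J assume J: "J \<subseteq> I"
    define F where "F = fst ` J"
    have F: "F \<subseteq> \<E>" "finite F"
      using J assms(1) finite_subset[of J I] by (auto simp: F_def I_def)
    have "J \<subseteq> F \<times> {..<k}" using J by (force simp: F_def I_def)
    then have "card J \<le> card F * k"
      using card_mono[of "F \<times> {..<k}" J] F by simp
    moreover have "card F * (d * k) \<le> card (\<Union>F) * d"
    proof (rule card_edges_bound)
      fix v show "card {e \<in> F. v \<in> e} \<le> d"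
        using F(1) assms(1) by (intro order.trans[OF card_mono assms(4)[of v]]) auto
    qed (use F assms in auto)
    then have "(card F * k) * d \<le> card (\<Union>F) * d" by (simp add: mult.commute mult.left_commute)
    then have "card F * k \<le> card (\<Union>F)" using assms(5) by (simp only: mult_le_cancel2)
    ultimately show "card J \<le> card (\<Union>(fst ` J))" unfolding F_def by linarith
  qed (use assms in \<open>auto simp: I_def\<close>)
  then obtain f where f: "inj_on f I" "\<And>i. i \<in> I \<Longrightarrow> f i \<in> fst i" by blast
  define c where "c v = (if v \<in> f ` I then snd (inv_into I f v) else 0)" for v
  have "c v < k" for v
    using inv_into_into[of v f I] assms(6) by (auto simp: c_def I_def)
  moreover have "{..<k} \<subseteq> c ` e" if e: "e \<in> \<E>" for e
  proof
    fix i assume "i \<in> {..<k}"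
    then have ei: "(e, i) \<in> I" using e by (simp add: I_def)
    then have "c (f (e, i)) = i" using f(1) by (simp add: c_def)
    then show "i \<in> c ` e" using f(2)[OF ei] by force
  qed
  ultimately show ?thesis by blast
qed

text \<open>Gaussian elimination: a pivot \<open>w\<close> of the equation \<open>e\<close> is
  eliminated from the other equations, which are solved without \<open>w\<close>; the value at
  \<open>w\<close> is then chosen so that \<open>e\<close> holds.\<close>

lemma underdetermined_system:
  fixes a :: "'e \<Rightarrow> 'a \<Rightarrow> real"
  assumes "finite E" "finite V" "card E < card V"
  shows "\<exists>y. (\<exists>v\<in>V. y v \<noteq> 0) \<and> (\<forall>e\<in>E. (\<Sum>v\<in>V. a e v * y v) = 0)"
  using assms
proof (induction E arbitrary: V a rule: finite_induct)
  case empty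
  then obtain v where "v \<in> V" by fastforce
  then show ?case by (intro exI[of _ "\<lambda>_. 1"]) auto
next
  case (insert e E)
  show ?case
  proof (cases "\<forall>v\<in>V. a e v = 0")
    case True
    then show ?thesis using insert.IH[of V a] insert.prems insert.hyps by auto
  next
    case False
    then obtain w where w: "w \<in> V" "a e w \<noteq> 0" by blast
    have "card E < card (V - {w})" using insert w by simp
    then obtain y where y: "\<exists>v\<in>V - {w}. y v \<noteq> 0"
      and y0: "\<And>g. g \<in> E \<Longrightarrow> (\<Sum>v\<in>V - {w}. (a g v - a g w * a e v / a e w) * y v) = 0"
      using insert.IH[of "V - {w}" "\<lambda>g v. a g v - a g w * a e v / a e w"] insert.prems by auto
    define s where "s = (\<Sum>v\<in>V - {w}. a e v * y v)"
    define z where "z = y(w := - s / a e w)"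
    have split: "(\<Sum>v\<in>V. a g v * z v) = (\<Sum>v\<in>V - {w}. a g v * y v) - a g w * s / a e w" for g
    proof -
      have "(\<Sum>v\<in>V - {w}. a g v * z v) = (\<Sum>v\<in>V - {w}. a g v * y v)"
        by (intro sum.cong) (auto simp: z_def)
      then show ?thesis
        using sum.remove[of V w "\<lambda>v. a g v * z v"] w insert.prems by (simp add: z_def)
    qed
    have "(\<Sum>v\<in>V. a g v * z v) = 0" if "g \<in> E" for g
    proof -
      have "(\<Sum>v\<in>V - {w}. (a g v - a g w * a e v / a e w) * y v)
          = (\<Sum>v\<in>V - {w}. a g v * y v) - a g w * s / a e w"
        by (simp add: s_def left_diff_distrib sum_subtractf sum_distrib_left sum_divide_distrib mult.assoc)
      then show ?thesis using split y0[OF that] by simp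
    qed
    moreover have "(\<Sum>v\<in>V. a e v * z v) = 0"
      using split[of e] w by (simp add: s_def)
    moreover have "\<exists>v\<in>V. z v \<noteq> 0" using y by (auto simp: z_def)
    ultimately show ?thesis by blast
  qed
qed

text \<open>Seymour's argument: a nonzero weighting that sums to zero on every edge bicolours, by signs,
  each edge that meets its support; the remaining edges avoid the support altogether.\<close>

lemma two_colouring_degree_3_size_4:
  assumes "finite V" "finite \<E>" "\<And>e. e \<in> \<E> \<Longrightarrow> e \<subseteq> V"
    and "\<And>e. e \<in> \<E> \<Longrightarrow> 4 \<le> card e" and "\<And>v. v \<in> V \<Longrightarrow> card {e \<in> \<E>. v \<in> e} \<le> 3"
  shows "\<exists>T. \<forall>e\<in>\<E>. e \<inter> T \<noteq> {} \<and> e - T \<noteq> {}"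
  using assms
proof (induction "card V" arbitrary: V \<E> rule: less_induct)
  case less
  show ?case
  proof (cases "\<E> = {}")
    case False
    \<comment> \<open>Counting incidences makes the edges fewer than the vertices, so the edge sums
      have a common nonzero zero. This is where edge size 4 must exceed degree 3.\<close>
    have "card \<E> * 4 \<le> card V * 3"
      using less.prems by (intro card_edges_bound) auto
    moreover have "card \<E> > 0" using False less.prems(2) by (simp add: card_gt_0_iff)
    ultimately have "card \<E> < card V" by linarith
    then obtain y :: "'a \<Rightarrow> real" where y: "\<exists>v\<in>V. y v \<noteq> 0"
      and y0: "\<And>e. e \<in> \<E> \<Longrightarrow> (\<Sum>v\<in>V. (if v \<in> e then 1 else 0) * y v) = 0"
      using underdetermined_system[of \<E> V "\<lambda>e v. if v \<in> e then 1 else 0"] less.prems(1,2) by blast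
    have sum0: "(\<Sum>v\<in>e. y v) = 0" if "e \<in> \<E>" for e
    proof -
      have "(\<Sum>v\<in>V. (if v \<in> e then 1 else 0) * y v) = (\<Sum>v\<in>V. if v \<in> e then y v else 0)"
        by (intro sum.cong) auto
      also have "\<dots> = (\<Sum>v\<in>e. y v)"
        using less.prems(1) less.prems(3)[OF that] by (simp add: sum.If_cases Int_absorb1)
      finally show ?thesis using y0[OF that] by simp
    qed
    define W where "W = {v \<in> V. y v = 0}"
    define \<F> where "\<F> = {e \<in> \<E>. e \<subseteq> W}"
    have "card W < card V" using y less.prems(1) by (intro psubset_card_mono) (auto simp: W_def)
    moreover have "card {e \<in> \<F>. v \<in> e} \<le> 3" if "v \<in> W" for v
      using that less.prems(2)
      by (intro order.trans[OF card_mono less.prems(5)[of v]]) (auto simp: \<F>_def W_def)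
    ultimately obtain T where T: "\<forall>e\<in>\<F>. e \<inter> T \<noteq> {} \<and> e - T \<noteq> {}"
      using less.hyps[of W \<F>] less.prems by (auto simp: W_def \<F>_def)
    define T' where "T' = (T \<inter> W) \<union> {v. y v > 0}"
    have "e \<inter> T' \<noteq> {} \<and> e - T' \<noteq> {}" if e: "e \<in> \<E>" for e
    proof (cases "e \<subseteq> W")
      case True
      then show ?thesis using T e by (fastforce simp: \<F>_def T'_def W_def)
    next
      case False
      then obtain v where v: "v \<in> e" "y v \<noteq> 0" using e less.prems(3) by (auto simp: W_def)
      have fe: "finite e" using e less.prems(1,3) finite_subset by blast
      have "\<exists>v\<in>e. y v > 0"
      proof (rule ccontr)
        assume "\<not> ?thesis"
        then have "\<forall>v\<in>e. - y v \<ge> 0" by auto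
        then have "\<forall>v\<in>e. - y v = 0"
          using sum_nonneg_eq_0_iff[of e "\<lambda>v. - y v"] fe sum0[OF e] by (simp add: sum_negf)
        then show False using v by auto
      qed
      moreover have "\<exists>v\<in>e. y v < 0"
      proof (rule ccontr)
        assume "\<not> ?thesis"
        then have "\<forall>v\<in>e. y v \<ge> 0" by auto
        then have "\<forall>v\<in>e. y v = 0"
          using sum_nonneg_eq_0_iff[of e y] fe sum0[OF e] by simp
        then show False using v by auto
      qed
      ultimately show ?thesis by (force simp: T'_def W_def)
    qed
    then show ?thesis by blast
  qed simp
qed

text \<open>Koenig's edge colouring theorem. Edges are abstract elements with end maps
  \<open>L\<close> and \<open>R\<close>, so parallel edges are allowed; they arise when two blocks
  share several points. Regularity yields Hall's condition, and a perfect matching can be split off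
  as one colour class.\<close>

lemma koenig_regular:
  fixes L :: "'e \<Rightarrow> 'a" and R :: "'e \<Rightarrow> 'b"
  assumes "finite E" "finite A" "finite B" "L ` E \<subseteq> A" "R ` E \<subseteq> B"
    and "\<And>a. a \<in> A \<Longrightarrow> card {e \<in> E. L e = a} = k"
    and "\<And>b. b \<in> B \<Longrightarrow> card {e \<in> E. R e = b} = k"
  shows "\<exists>c. (\<forall>a\<in>A. {..<k} \<subseteq> c ` {e \<in> E. L e = a}) \<and> (\<forall>b\<in>B. {..<k} \<subseteq> c ` {e \<in> E. R e = b})"
  using assms
proof (induction k arbitrary: E)
  case (Suc k)
  have cnt: "card D = Suc k * card S"
    if "finite S" "D = {e \<in> E. h e \<in> S}" "\<And>a. a \<in> S \<Longrightarrow> card {e \<in> E. h e = a} = Suc k"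
    for S and h :: "'e \<Rightarrow> 'c" and D
  proof -
    have "D = (\<Union>a\<in>S. {e \<in> E. h e = a})" using that(2) by auto
    then have "card D = (\<Sum>a\<in>S. card {e \<in> E. h e = a})"
      using that(1) Suc.prems(1) by (simp only:, subst card_UN_disjoint) auto
    then show ?thesis using that(3) by simp
  qed
  have "\<exists>f. inj_on f A \<and> (\<forall>a\<in>A. f a \<in> R ` {e \<in> E. L e = a})"
  proof (rule hall_marriage)
    fix J assume J: "J \<subseteq> A"
    define N where "N = (\<Union>a\<in>J. R ` {e \<in> E. L e = a})"
    have fJ: "finite J" using J Suc.prems(2) finite_subset by blast
    have N: "N \<subseteq> B" using Suc.prems(5) by (auto simp: N_def)
    then have fN: "finite N" using Suc.prems(3) finite_subset by blast
    have "card {e \<in> E. L e \<in> J} = Suc k * card J"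
      by (rule cnt[of J _ L]) (use J fJ Suc.prems(6) in auto)
    moreover have "card {e \<in> E. R e \<in> N} = Suc k * card N"
      by (rule cnt[of N _ R]) (use N fN Suc.prems(7) in auto)
    moreover have "card {e \<in> E. L e \<in> J} \<le> card {e \<in> E. R e \<in> N}"
      by (rule card_mono) (use Suc.prems(1) in \<open>auto simp: N_def\<close>)
    ultimately show "card J \<le> card (\<Union>((\<lambda>a. R ` {e \<in> E. L e = a}) ` J))"
      unfolding N_def[symmetric] by (metis Suc_mult_le_cancel1)
  qed (use Suc.prems in auto)
  then obtain f where f: "inj_on f A" "\<And>a. a \<in> A \<Longrightarrow> \<exists>e\<in>E. L e = a \<and> R e = f a" by force
  then obtain m where m: "\<And>a. a \<in> A \<Longrightarrow> m a \<in> E \<and> L (m a) = a \<and> R (m a) = f a" by metis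
  \<comment> \<open>Counting the edges from both sides shows that the sides have equal size, so the
    matching that saturates \<open>A\<close> also saturates \<open>B\<close>.\<close>
  have "card E = Suc k * card A"
    by (rule cnt[of A E L]) (use Suc.prems in auto)
  moreover have "card E = Suc k * card B"
    by (rule cnt[of B E R]) (use Suc.prems in auto)
  ultimately have "card A = card B" by (metis Suc_mult_cancel1)
  moreover have "f ` A \<subseteq> B" using m Suc.prems(5) by force
  ultimately have fA: "f ` A = B" using f(1) Suc.prems(3) by (metis card_image card_subset_eq)
  define M where "M = m ` A"
  have Lfib: "{e \<in> M. L e = a} = {m a}" if "a \<in> A" for a using m that by (auto simp: M_def)
  have Rfib: "\<exists>x. {e \<in> M. R e = b} = {x}" if b: "b \<in> B" for b
  proof -
    obtain a where a: "a \<in> A" "f a = b" using fA b by blast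
    then have "{e \<in> M. R e = b} = {m a}" using m f(1) by (auto simp: M_def inj_on_def)
    then show ?thesis by blast
  qed
  have ME: "M \<subseteq> E" using m by (auto simp: M_def)
  have diff: "card {e \<in> E - M. h e = a} = k"
    if "{e \<in> M. h e = a} = {x}" "card {e \<in> E. h e = a} = Suc k" for h :: "'e \<Rightarrow> 'c" and a x
  proof -
    have "{e \<in> E - M. h e = a} = {e \<in> E. h e = a} - {x}" using that(1) by auto
    moreover have "x \<in> {e \<in> E. h e = a}" using that(1) ME by auto
    ultimately show ?thesis using that(2) by simp
  qed
  have "card {e \<in> E - M. L e = a} = k" if "a \<in> A" for a
    by (rule diff[OF Lfib[OF that] Suc.prems(6)[OF that]])
  moreover have "card {e \<in> E - M. R e = b} = k" if "b \<in> B" for b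
    using Rfib[OF that] diff[OF _ Suc.prems(7)[OF that]] by blast
  ultimately have "\<exists>c. (\<forall>a\<in>A. {..<k} \<subseteq> c ` {e \<in> E - M. L e = a}) \<and> (\<forall>b\<in>B. {..<k} \<subseteq> c ` {e \<in> E - M. R e = b})"
    using Suc.prems by (intro Suc.IH) auto
  then obtain c where
    c: "\<forall>a\<in>A. {..<k} \<subseteq> c ` {e \<in> E - M. L e = a}" "\<forall>b\<in>B. {..<k} \<subseteq> c ` {e \<in> E - M. R e = b}"
    by blast
  define c' where "c' e = (if e \<in> M then k else c e)" for e
  have extend: "{..<Suc k} \<subseteq> c' ` {e \<in> E. h e = a}"
    if "{..<k} \<subseteq> c ` {e \<in> E - M. h e = a}" "{e \<in> M. h e = a} = {x}" for h :: "'e \<Rightarrow> 'c" and a x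
  proof
    fix i assume "i \<in> {..<Suc k}"
    then consider "i < k" | "i = k" by force
    then show "i \<in> c' ` {e \<in> E. h e = a}"
    proof cases
      case 1
      then show ?thesis using that(1) by (force simp: c'_def)
    next
      case 2
      have "x \<in> M" "h x = a" using that(2) by auto
      then show ?thesis using 2 ME by (intro image_eqI[of _ _ x]) (auto simp: c'_def)
    qed
  qed
  show ?case
  proof (intro exI[of _ c'] conjI ballI)
    fix a assume "a \<in> A"
    then show "{..<Suc k} \<subseteq> c' ` {e \<in> E. L e = a}" by (intro extend[OF bspec[OF c(1)] Lfib])
  next
    fix b assume b: "b \<in> B"
    then obtain x where "{e \<in> M. R e = b} = {x}" using Rfib by blast
    then show "{..<Suc k} \<subseteq> c' ` {e \<in> E. R e = b}" by (rule extend[OF bspec[OF c(2) b]])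
  qed
qed simp

section \<open>Strips\<close>

text \<open>"At least \<open>m\<close>" and not "exactly \<open>m\<close>": once points have been
  set aside, only a lower bound on the number of remaining points of a range is known. Colours
  outside \<open>{..<k}\<close> are tolerated here and removed in \<open>m_R_le\<close>.\<close>

definition colourable :: "nat \<Rightarrow> 'a set \<Rightarrow> 'a set set \<Rightarrow> nat \<Rightarrow> bool" where
  "colourable k V \<R> m \<longleftrightarrow> (\<exists>c. \<forall>R\<in>\<R>. m \<le> card (V \<inter> R) \<longrightarrow> {..<k} \<subseteq> c ` (V \<inter> R))"

definition strips :: "('a \<Rightarrow> real) \<Rightarrow> 'a set set" where
  "strips f = {{v. a \<le> f v \<and> f v \<le> b} | a b. True}"

definition rank :: "('a \<Rightarrow> real) \<Rightarrow> 'a set \<Rightarrow> 'a \<Rightarrow> nat" where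
  "rank f V v = card {u \<in> V. f u < f v}"

text \<open>The index stops before \<open>card V div s\<close>, so an incomplete last group is
  dropped and every block has exactly \<open>s\<close> points.\<close>

definition blocks :: "('a \<Rightarrow> real) \<Rightarrow> 'a set \<Rightarrow> nat \<Rightarrow> 'a set set" where
  "blocks f V s = (\<lambda>i. {v \<in> V. rank f V v div s = i}) ` {..<card V div s}"

lemma rank_less:
  assumes "finite V" "u \<in> V" "f u < f v"
  shows "rank f V u < rank f V v"
  unfolding rank_def using assms by (intro psubset_card_mono) auto

lemma rank_le_imp_le:
  assumes "finite V" "v \<in> V" "rank f V u \<le> rank f V v"
  shows "f u \<le> f v"
  using rank_less[of V v f u] assms by force

lemma bij_betw_rank:
  assumes "finite V" "inj_on f V"
  shows "bij_betw (rank f V) V {..<card V}"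
proof -
  have inj: "inj_on (rank f V) V"
  proof (rule inj_onI)
    fix u v assume "u \<in> V" "v \<in> V" "rank f V u = rank f V v"
    then have "f u = f v" using rank_less[OF assms(1), of _ f] by (metis less_irrefl linorder_neqE)
    then show "u = v" using assms(2) \<open>u \<in> V\<close> \<open>v \<in> V\<close> by (auto dest: inj_onD)
  qed
  have "rank f V ` V \<subseteq> {..<card V}"
    using assms(1) by (auto simp: rank_def intro!: psubset_card_mono)
  then have "rank f V ` V = {..<card V}"
    using card_image[OF inj] by (intro card_subset_eq) auto
  then show ?thesis using inj by (simp add: bij_betw_def)
qed

lemma div_fibre: "0 < s \<Longrightarrow> {j. j div s = i} = {i * s..<i * s + s}" for i j s :: nat
  by (auto simp: set_eq_iff div_nat_eqI mult.commute) (metis add.commute dividend_less_div_times mult.commute)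

lemma card_block:
  assumes "finite V" "inj_on f V" "0 < s" "B \<in> blocks f V s"
  shows "card B = s"
proof -
  obtain i where i: "i < card V div s" "B = {v \<in> V. rank f V v div s = i}"
    using assms(4) by (auto simp: blocks_def)
  have "(i + 1) * s \<le> card V div s * s" using i(1) by (intro mult_right_mono) auto
  also have "\<dots> \<le> card V" by simp
  finally have le: "i * s + s \<le> card V" by simp
  have "rank f V ` B = {i * s..<i * s + s}"
  proof -
    have "rank f V ` B = {j \<in> rank f V ` V. j div s = i}" by (auto simp: i(2))
    also have "\<dots> = {j. j div s = i} \<inter> {..<card V}"
      using bij_betw_rank[OF assms(1,2)] by (auto simp: bij_betw_def)
    also have "\<dots> = {i * s..<i * s + s}" using le assms(3) by (auto simp: div_fibre)
    finally show ?thesis .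
  qed
  moreover have "inj_on (rank f V) B"
    using bij_betw_rank[OF assms(1,2)] i(2) by (auto simp: bij_betw_def intro: inj_on_subset)
  ultimately show ?thesis using card_image by fastforce
qed

lemma finite_blocks: "finite (blocks f V s)"
  by (simp add: blocks_def)

lemma block_subset: "B \<in> blocks f V s \<Longrightarrow> B \<subseteq> V"
  by (auto simp: blocks_def)

lemma card_blocks_containing: "card {B \<in> blocks f V s. v \<in> B} \<le> 1"
proof -
  have "{B \<in> blocks f V s. v \<in> B} \<subseteq> {{u \<in> V. rank f V u div s = rank f V v div s}}"
    by (auto simp: blocks_def)
  from card_mono[OF _ this] show ?thesis by simp
qed

text \<open>Among the first \<open>s\<close> ranks of a run of length \<open>2 * s - 1\<close> there
  is a multiple of \<open>s\<close>, and the \<open>s\<close> ranks that start there still belong to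
  the run.\<close>

lemma strip_contains_block:
  assumes "finite V" "inj_on f V" "0 < s" "R \<in> strips f" "2 * s - 1 \<le> card (V \<inter> R)"
  shows "\<exists>B\<in>blocks f V s. B \<subseteq> V \<inter> R"
proof -
  define W where "W = rank f V ` (V \<inter> R)"
  have inj: "inj_on (rank f V) V" and img: "rank f V ` V = {..<card V}"
    using bij_betw_rank[OF assms(1,2)] by (auto simp: bij_betw_def)
  have W: "finite W" "W \<subseteq> {..<card V}" "2 * s - 1 \<le> card W"
    using assms(1,5) img card_image[of "rank f V" "V \<inter> R"] inj
    by (auto simp: W_def inj_on_Int)
  then have ne: "W \<noteq> {}" using assms(3) by auto
  define l u where "l = Min W" and "u = Max W"
  have lu: "l \<in> W" "u \<in> W" "W \<subseteq> {l..u}" using W(1) ne by (auto simp: l_def u_def)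
  have "card W \<le> u + 1 - l" using card_mono[OF _ lu(3)] by simp
  then have len: "l + (2 * s - 1) \<le> u + 1" using W(3) lu(1,3) by auto
  \<comment> \<open>Division rounded up: \<open>i * s\<close> is the least multiple of
    \<open>s\<close> that is at least \<open>l\<close>.\<close>
  define i where "i = (l + (s - 1)) div s"
  have i1: "i * s \<le> l + (s - 1)" by (simp add: i_def)
  have "l + (s - 1) < i * s + s"
    using dividend_less_div_times[OF assms(3), of "l + (s - 1)"] by (simp add: i_def add.commute)
  then have i2: "l \<le> i * s" by linarith
  have i3: "i * s + s \<le> u + 1" using i1 len assms(3) by linarith
  have "u < card V" using lu(2) W(2) by auto
  then have "Suc i * s \<le> card V" using i3 by simp
  then have iV: "i < card V div s"
    using assms(3) by (metis Suc_le_eq less_eq_div_iff_mult_less_eq)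
  have "v \<in> R" if v: "v \<in> V" "rank f V v div s = i" for v
  proof -
    have "rank f V v \<in> {i * s..<i * s + s}" using v(2) div_fibre[OF assms(3), of i] by blast
    then have "l \<le> rank f V v" "rank f V v \<le> u" using i2 i3 by auto
    moreover obtain x y where "x \<in> V \<inter> R" "y \<in> V \<inter> R" "l = rank f V x" "u = rank f V y"
      using lu by (auto simp: W_def)
    ultimately show ?thesis
      using rank_le_imp_le[OF assms(1), of v f x] rank_le_imp_le[OF assms(1), of y f v] v(1) assms(4)
      by (fastforce simp: strips_def)
  qed
  then show ?thesis using iV
    by (intro bexI[of _ "{v \<in> V. rank f V v div s = i}"]) (auto simp: blocks_def)
qed

lemma colourable_strips_of_blocks:
  assumes "finite V" "0 < s" "\<And>f. f \<in> F \<Longrightarrow> inj_on f V"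
    and "\<And>f B. f \<in> F \<Longrightarrow> B \<in> blocks f V s \<Longrightarrow> {..<k} \<subseteq> c ` B"
  shows "colourable k V (\<Union>(strips ` F)) (2 * s - 1)"
  unfolding colourable_def
proof (intro exI[of _ c] ballI impI)
  fix R assume "R \<in> \<Union>(strips ` F)" "2 * s - 1 \<le> card (V \<inter> R)"
  then obtain f B where "f \<in> F" "B \<in> blocks f V s" "B \<subseteq> V \<inter> R"
    using strip_contains_block[OF assms(1) assms(3) assms(2)] by blast
  then show "{..<k} \<subseteq> c ` (V \<inter> R)" using assms(4) by blast
qed

text \<open>Blocks of one order are disjoint, so each order adds at most one to the degree of a
  point.\<close>

lemma card_blocks_containing_family:
  assumes "finite F"
  shows "card {B \<in> (\<Union>f\<in>F. blocks f V s). v \<in> B} \<le> card F"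
proof -
  have "{B \<in> (\<Union>f\<in>F. blocks f V s). v \<in> B} = (\<Union>f\<in>F. {B \<in> blocks f V s. v \<in> B})" by auto
  then have "card {B \<in> (\<Union>f\<in>F. blocks f V s). v \<in> B} \<le> (\<Sum>f\<in>F. card {B \<in> blocks f V s. v \<in> B})"
    using card_UN_le[OF assms, of "\<lambda>f. {B \<in> blocks f V s. v \<in> B}"] by simp
  also have "\<dots> \<le> card F"
    by (rule order.trans[OF sum_mono[OF card_blocks_containing]]) simp
  finally show ?thesis .
qed

text \<open>The block size \<open>card F * k\<close> is degree times number of colours, exactly what
  the Hall argument requires.\<close>

lemma colourable_strips:
  assumes "finite V" "finite F" "F \<noteq> {}" "\<And>f. f \<in> F \<Longrightarrow> inj_on f V" "0 < k"
  shows "colourable k V (\<Union>(strips ` F)) (2 * (card F * k) - 1)"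
proof -
  let ?s = "card F * k"
  have s: "0 < ?s" using assms(2,3,5) by (simp add: card_gt_0_iff)
  have "\<exists>c. (\<forall>v. c v < k) \<and> (\<forall>B\<in>(\<Union>f\<in>F. blocks f V ?s). {..<k} \<subseteq> c ` B)"
  proof (rule polychromatic_of_bounded_degree[where d = "card F"])
    fix B assume "B \<in> (\<Union>f\<in>F. blocks f V ?s)"
    then obtain f where "f \<in> F" "B \<in> blocks f V ?s" by blast
    then show "finite B" "card F * k \<le> card B"
      using finite_subset[OF block_subset assms(1)] card_block[OF assms(1) assms(4) s] by auto
  next
    show "card {B \<in> (\<Union>f\<in>F. blocks f V ?s). v \<in> B} \<le> card F" for v
      by (rule card_blocks_containing_family[OF assms(2)])
  qed (use assms(2,3,5) in \<open>auto simp: finite_blocks card_gt_0_iff\<close>)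
  then obtain c where c: "\<forall>B\<in>(\<Union>f\<in>F. blocks f V ?s). {..<k} \<subseteq> c ` B" by (elim exE conjE)
  show ?thesis
    by (rule colourable_strips_of_blocks[OF assms(1) s assms(4) bspec[OF c UN_I]])
qed

text \<open>With only two colours the sign argument needs a block size one above the degree, so 4 in
  place of 6; the threshold is 2 * 4 - 1.\<close>

lemma two_colourable_three_strips:
  assumes "finite V" "card F \<le> 3" "finite F" "\<And>f. f \<in> F \<Longrightarrow> inj_on f V"
  shows "colourable 2 V (\<Union>(strips ` F)) 7"
proof -
  have "\<exists>T. \<forall>B\<in>(\<Union>f\<in>F. blocks f V 4). B \<inter> T \<noteq> {} \<and> B - T \<noteq> {}"
  proof (rule two_colouring_degree_3_size_4)
    fix v show "card {B \<in> (\<Union>f\<in>F. blocks f V 4). v \<in> B} \<le> 3"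
      using card_blocks_containing_family[OF assms(3)] assms(2) by (rule order.trans)
  next
    fix B assume "B \<in> (\<Union>f\<in>F. blocks f V 4)"
    then obtain f where "f \<in> F" "B \<in> blocks f V 4" by blast
    then show "B \<subseteq> V" "4 \<le> card B" using block_subset[of B f V 4] card_block[OF assms(1) assms(4), of f 4] by auto
  qed (use assms(1,3) in \<open>auto simp: finite_blocks\<close>)
  then obtain T where T: "\<forall>B\<in>(\<Union>f\<in>F. blocks f V 4). B \<inter> T \<noteq> {} \<and> B - T \<noteq> {}" by (elim exE)
  have col: "{..<2} \<subseteq> (\<lambda>v. if v \<in> T then 0 else 1 :: nat) ` B" if "f \<in> F" "B \<in> blocks f V 4" for f B
    using bspec[OF T UN_I, OF that] by (force simp: numeral_2_eq_2 lessThan_Suc)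
  have "colourable 2 V (\<Union>(strips ` F)) (2 * 4 - 1)"
    by (rule colourable_strips_of_blocks[OF assms(1) _ assms(4) col]) auto
  then show ?thesis by simp
qed

section \<open>Two strip directions as a bipartite edge colouring\<close>

lemma bij_betw_Collect_comp:
  assumes "bij_betw h A B"
  shows "bij_betw h {x \<in> A. P (h x)} {y \<in> B. P y}"
  using assms by (auto simp: bij_betw_def inj_on_def)

text \<open>Ranks are padded beyond \<open>card V\<close> by dummy points, ranked alike in both orders, so that
  the bipartite graph between the blocks of the two orders becomes \<open>k\<close>-regular.\<close>

lemma colourable_two_strips:
  assumes "finite V" "inj_on f V" "inj_on g V" "0 < k"
  shows "colourable k V (strips f \<union> strips g) (2 * k - 1)"
proof -
  \<comment> \<open>With \<open>k * card V\<close> padded ranks, each order has exactly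
    \<open>card V\<close> blocks and all of them are full.\<close>
  let ?n = "card V" and ?N = "k * card V"
  define \<rho> where "\<rho> = rank f V"
  define \<sigma> where "\<sigma> = rank g V"
  have \<rho>: "bij_betw \<rho> V {..<?n}" and \<sigma>: "bij_betw \<sigma> V {..<?n}"
    using bij_betw_rank assms by (auto simp: \<rho>_def \<sigma>_def)
  have nN: "?n \<le> ?N" using assms(4) by simp
  \<comment> \<open>\<pi> turns a rank for \<open>f\<close> into the rank for \<open>g\<close> of
    the same point. The edge \<open>e\<close> joins the block \<open>e div k\<close> of the first
    order to the block \<open>\<pi> e div k\<close> of the second.\<close>
  define \<pi> where "\<pi> i = (if i < ?n then \<sigma> (inv_into V \<rho> i) else i)" for i
  have "bij_betw (\<sigma> \<circ> inv_into V \<rho>) {..<?n} {..<?n}"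
    using bij_betw_inv_into[OF \<rho>] \<sigma> by (rule bij_betw_trans)
  then have "bij_betw \<pi> {..<?n} {..<?n}" by (rule bij_betw_cong[THEN iffD1, rotated]) (auto simp: \<pi>_def)
  moreover have "bij_betw \<pi> {?n..<?N} {?n..<?N}"
    by (rule bij_betw_cong[THEN iffD1, OF _ bij_betw_id]) (auto simp: \<pi>_def)
  ultimately have "bij_betw \<pi> ({..<?n} \<union> {?n..<?N}) ({..<?n} \<union> {?n..<?N})"
    by (rule bij_betw_combine) auto
  moreover have "{..<?n} \<union> {?n..<?N} = {..<?N}" by (rule ivl_disj_un_one(2)[OF nN])
  ultimately have \<pi>: "bij_betw \<pi> {..<?N} {..<?N}" by simp
  have fib: "{j \<in> {..<?N}. j div k = a} = {a * k..<a * k + k}" if "a < ?n" for a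
  proof -
    have "Suc a * k \<le> ?n * k" using that by (intro mult_right_mono) auto
    then show ?thesis using div_fibre[OF assms(4), of a] by (auto simp: mult.commute)
  qed
  have divN: "j div k < ?n" if "j < ?N" for j
    using that assms(4) by (simp add: less_mult_imp_div_less mult.commute)
  have "\<exists>c. (\<forall>a\<in>{..<?n}. {..<k} \<subseteq> c ` {e \<in> {..<?N}. e div k = a})
    \<and> (\<forall>b\<in>{..<?n}. {..<k} \<subseteq> c ` {e \<in> {..<?N}. \<pi> e div k = b})"
  proof (rule koenig_regular)
    show "card {e \<in> {..<?N}. \<pi> e div k = b} = k" if "b \<in> {..<?n}" for b
    proof -
      have "bij_betw \<pi> {e \<in> {..<?N}. \<pi> e div k = b} {j \<in> {..<?N}. j div k = b}"
        by (rule bij_betw_Collect_comp[OF \<pi>])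
      from bij_betw_same_card[OF this] show ?thesis using fib[of b] that by simp
    qed
    show "(\<lambda>e. \<pi> e div k) ` {..<?N} \<subseteq> {..<?n}"
      using divN \<pi> by (auto simp: bij_betw_def)
  qed (use fib divN in auto)
  then obtain c where cf: "\<forall>a\<in>{..<?n}. {..<k} \<subseteq> c ` {e \<in> {..<?N}. e div k = a}"
    and cg: "\<forall>b\<in>{..<?n}. {..<k} \<subseteq> c ` {e \<in> {..<?N}. \<pi> e div k = b}"
    by (elim exE conjE)
  \<comment> \<open>Blocks with index below \<open>card V div k\<close> contain no dummy, so the
    colours found there are colours of actual points.\<close>
  have full: "j < ?n" if "j div k < ?n div k" for j
    using that div_le_mono linorder_not_less by blast
  have bn: "i \<in> {..<?n}" if "i < ?n div k" for i
    using order_less_le_trans[OF that div_le_dividend] by simp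
  have col: "{..<k} \<subseteq> (c \<circ> \<rho>) ` B" if h: "h \<in> {f, g}" "B \<in> blocks h V k" for h B
  proof -
    obtain i where i: "i < ?n div k" "B = {v \<in> V. rank h V v div k = i}"
      using h(2) by (auto simp: blocks_def)
    have inv: "inv_into V \<rho> e \<in> V" "\<rho> (inv_into V \<rho> e) = e" if "e < ?n" for e
      using that \<rho> by (auto simp: bij_betw_def inv_into_into f_inv_into_f)
    show ?thesis
    proof (cases "h = f")
      case True
      have "{e \<in> {..<?N}. e div k = i} \<subseteq> \<rho> ` B"
      proof
        fix e assume "e \<in> {e \<in> {..<?N}. e div k = i}"
        then show "e \<in> \<rho> ` B"
          using inv[of e] full[of e] i True by (intro image_eqI[of _ _ "inv_into V \<rho> e"]) (auto simp: \<rho>_def)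
      qed
      from order.trans[OF bspec[OF cf bn[OF i(1)]] image_mono[OF this]] show ?thesis
        by (simp only: image_comp)
    next
      case False
      have "{e \<in> {..<?N}. \<pi> e div k = i} \<subseteq> \<rho> ` B"
      proof
        fix e assume e: "e \<in> {e \<in> {..<?N}. \<pi> e div k = i}"
        then have "\<pi> e < ?n" using full i by auto
        then have en: "e < ?n" by (auto simp: \<pi>_def split: if_splits)
        then show "e \<in> \<rho> ` B"
          using inv[of e] e i False h(1)
          by (intro image_eqI[of _ _ "inv_into V \<rho> e"]) (auto simp: \<sigma>_def \<pi>_def)
      qed
      from order.trans[OF bspec[OF cg bn[OF i(1)]] image_mono[OF this]] show ?thesis
        by (simp only: image_comp)
    qed
  qed
  have "colourable k V (\<Union>(strips ` {f, g})) (2 * k - 1)"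
    by (rule colourable_strips_of_blocks[OF assms(1,4) _ col]) (use assms in auto)
  then show ?thesis by simp
qed

section \<open>Quadrants and chain-convex ranges\<close>

definition quadrants :: "('a \<Rightarrow> real) \<Rightarrow> ('a \<Rightarrow> real) \<Rightarrow> 'a set set" where
  "quadrants f g = {{v. f v \<le> a \<and> b \<le> g v} | a b. True}"

definition chain_convex :: "('a \<Rightarrow> real) \<Rightarrow> ('a \<Rightarrow> real) \<Rightarrow> 'a set \<Rightarrow> bool" where
  "chain_convex f g R \<longleftrightarrow>
    (\<forall>p\<in>R. \<forall>r\<in>R. \<forall>z. f p < f z \<and> f z < f r \<and> g p < g z \<and> g z < g r \<longrightarrow> z \<in> R)"

lemma chain_convex_quadrant: "Q \<in> quadrants f g \<Longrightarrow> chain_convex f g Q"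
  by (force simp: quadrants_def chain_convex_def)

lemma obtain_increasing_triple:
  fixes f :: "'a \<Rightarrow> real"
  assumes "finite S" "inj_on f S" "3 \<le> card S"
  obtains p q r where "p \<in> S" "q \<in> S" "r \<in> S" "f p < f q" "f q < f r"
proof -
  have ne: "S \<noteq> {}" using assms(3) by auto
  obtain p where p: "p \<in> S" "\<And>x. x \<in> S \<Longrightarrow> f p \<le> f x"
    using ex_min_if_finite[of "f ` S"] ne assms(1) by (metis (no_types, lifting) arg_min_if_finite(1) arg_min_least)
  have "card (S - {p}) \<ge> 2" using p assms by simp
  then have ne2: "S - {p} \<noteq> {}" by (metis card.empty not_numeral_le_zero)
  obtain q where q: "q \<in> S - {p}" "\<And>x. x \<in> S - {p} \<Longrightarrow> f q \<le> f x"
    using ne2 assms(1) by (metis (no_types, lifting) arg_min_if_finite(1) arg_min_least finite_Diff)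
  have "card (S - {p} - {q}) \<ge> 1" using \<open>card (S - {p}) \<ge> 2\<close> q assms(1) by simp
  then obtain r where r: "r \<in> S - {p} - {q}" by (metis all_not_in_conv card.empty not_one_le_zero)
  have "f p \<noteq> f q" "f q \<noteq> f r" using p(1) q(1) r assms(2) by (auto dest: inj_onD)
  then show thesis using p q r that by (metis DiffD1 order_less_le)
qed

text \<open>Take a minimal hitting set \<open>H\<close> among the points that are extremal for \<open>quadrants f g\<close>; it is
  a chain. If \<open>p < q < r\<close> in \<open>H\<close> lie in \<open>R\<close>, then the quadrant that makes \<open>q\<close> indispensable is
  squeezed between \<open>p\<close> and \<open>r\<close>, so \<open>R\<close> contains it.\<close>

lemma shallow_hitting_set:
  assumes "finite V" "inj_on f V" "inj_on g V" "0 < m"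
  shows "\<exists>H\<subseteq>V. (\<forall>Q\<in>quadrants f g. m \<le> card (V \<inter> Q) \<longrightarrow> Q \<inter> H \<noteq> {})
    \<and> (\<forall>R. chain_convex f g R \<longrightarrow> m \<le> card (V \<inter> R) \<longrightarrow> m - 2 \<le> card ((V - H) \<inter> R))"
proof -
  \<comment> \<open>The records: points whose \<open>g\<close> exceeds that of every point with
    smaller \<open>f\<close>. A quadrant that meets \<open>V\<close> contains one, namely its point
    with least \<open>f\<close>.\<close>
  define L where "L = {v \<in> V. \<forall>u\<in>V. f u < f v \<longrightarrow> g u < g v}"
  define hits where "hits H \<longleftrightarrow> H \<subseteq> L \<and> (\<forall>Q\<in>quadrants f g. m \<le> card (V \<inter> Q) \<longrightarrow> Q \<inter> H \<noteq> {})" for H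
  have "Q \<inter> L \<noteq> {}" if Q: "Q \<in> quadrants f g" "m \<le> card (V \<inter> Q)" for Q
  proof -
    have "V \<inter> Q \<noteq> {}" using Q(2) assms(4) by auto
    then obtain v where v: "v \<in> V \<inter> Q" "\<And>u. u \<in> V \<inter> Q \<Longrightarrow> f v \<le> f u"
      using assms(1) by (metis (no_types, lifting) arg_min_if_finite(1) arg_min_least finite_Int)
    have "g u < g v" if "u \<in> V" "f u < f v" for u
      using v(1) v(2)[of u] that Q(1) by (fastforce simp: quadrants_def)
    then show ?thesis using v(1) by (auto simp: L_def)
  qed
  then have "hits L" by (simp add: hits_def)
  then obtain H where H: "hits H" "\<And>H'. hits H' \<Longrightarrow> card H \<le> card H'"
    using ex_has_least_nat[of hits L card] by blast
  have HV: "H \<subseteq> L" "H \<subseteq> V" using H(1) by (auto simp: hits_def L_def)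
  have finH: "finite H" using HV(2) assms(1) finite_subset by blast
  have priv: "\<exists>Q\<in>quadrants f g. m \<le> card (V \<inter> Q) \<and> Q \<inter> H = {q}" if q: "q \<in> H" for q
  proof -
    have "card (H - {q}) < card H" using q finH by (intro psubset_card_mono) auto
    then have "\<not> hits (H - {q})" using H(2) linorder_not_less by blast
    then obtain Q where Q: "Q \<in> quadrants f g" "m \<le> card (V \<inter> Q)" "Q \<inter> (H - {q}) = {}"
      using HV(1) by (auto simp: hits_def)
    moreover have "Q \<inter> H \<noteq> {}" using Q H(1) by (auto simp: hits_def)
    ultimately show ?thesis by blast
  qed
  have "m - 2 \<le> card ((V - H) \<inter> R)" if R: "chain_convex f g R" "m \<le> card (V \<inter> R)" for R
  proof (cases "card (H \<inter> R) \<le> 2")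
    case True
    have "(V - H) \<inter> R = V \<inter> R - H \<inter> R" by auto
    then show ?thesis using R(2) True finH diff_card_le_card_Diff[of "H \<inter> R" "V \<inter> R"] by simp
  next
    case False
    then have "3 \<le> card (H \<inter> R)" by simp
    then obtain p q r where pqr: "p \<in> H \<inter> R" "q \<in> H \<inter> R" "r \<in> H \<inter> R" "f p < f q" "f q < f r"
      using obtain_increasing_triple[of "H \<inter> R" f] finH HV(2) assms(2) by (metis finite_Int inf_le1 inj_on_subset)
    obtain Q where Q: "Q \<in> quadrants f g" "m \<le> card (V \<inter> Q)" "Q \<inter> H = {q}"
      using priv pqr(2) by blast
    then obtain a b where ab: "Q = {v. f v \<le> a \<and> b \<le> g v}" by (auto simp: quadrants_def)
    have q: "f q \<le> a" "b \<le> g q" using Q(3) ab by auto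
    have "p \<notin> Q" using Q(3) pqr by auto
    then have gp: "g p < b" using ab q pqr(4) by auto
    have "g q < g r" using pqr HV by (auto simp: L_def)
    moreover have "r \<notin> Q" using Q(3) pqr by auto
    ultimately have fr: "a < f r" using ab q by auto
    \<comment> \<open>A point of \<open>Q\<close> has larger \<open>g\<close> than the record
      \<open>p\<close>, so it cannot lie to the left of \<open>p\<close>; it lies to the left of the
      record \<open>r\<close>, so its \<open>g\<close> is below that of \<open>r\<close>.\<close>
    have "z \<in> R" if z: "z \<in> V" "z \<in> Q" for z
    proof -
      have zz: "f z \<le> a" "b \<le> g z" using z(2) ab by auto
      have "\<not> f z < f p" using zz gp z(1) pqr(1) HV(1) by (force simp: L_def)
      moreover have "f z \<noteq> f p" using zz gp z(1) pqr(1) HV(2) assms(2) by (force dest: inj_onD)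
      moreover have "g z < g r" using zz fr z(1) pqr(3) HV(1) by (force simp: L_def)
      ultimately have "f p < f z \<and> f z < f r \<and> g p < g z \<and> g z < g r" using zz gp fr by auto
      then show ?thesis using R(1) pqr unfolding chain_convex_def by blast
    qed
    \<comment> \<open>\<open>Q\<close> contains no point of \<open>H\<close> but \<open>q\<close>,
      so in this case \<open>R\<close> keeps at least \<open>m - 1\<close> points.\<close>
    then have "V \<inter> Q - {q} \<subseteq> (V - H) \<inter> R" using Q(3) by blast
    then have "card (V \<inter> Q - {q}) \<le> card ((V - H) \<inter> R)" using assms(1) by (intro card_mono) auto
    moreover have "q \<in> V \<inter> Q" using Q(3) HV(2) by auto
    ultimately show ?thesis using Q(2) by simp
  qed
  then show ?thesis using H(1) HV(2) by (intro exI[of _ H]) (simp add: hits_def)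
qed

text \<open>Hitting sets are taken repeatedly from the uncoloured rest. The quadrants being coloured
  are chain-convex themselves, so each round leaves them the \<open>m - 2\<close> points that the
  next round needs.\<close>

lemma quadrants_partial_colouring:
  assumes "finite V" "inj_on f V" "inj_on g V" "2 * k \<le> m"
  shows "\<exists>X c. X \<subseteq> V \<and> (\<forall>Q\<in>quadrants f g. m \<le> card (V \<inter> Q) \<longrightarrow> {..<k} \<subseteq> c ` (X \<inter> Q))
    \<and> (\<forall>R. chain_convex f g R \<longrightarrow> m \<le> card (V \<inter> R) \<longrightarrow> m - 2 * k \<le> card ((V - X) \<inter> R))"
  using assms
proof (induction k arbitrary: V m)
  case (Suc k)
  obtain H where H: "H \<subseteq> V" "\<forall>Q\<in>quadrants f g. m \<le> card (V \<inter> Q) \<longrightarrow> Q \<inter> H \<noteq> {}"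
    "\<forall>R. chain_convex f g R \<longrightarrow> m \<le> card (V \<inter> R) \<longrightarrow> m - 2 \<le> card ((V - H) \<inter> R)"
    using shallow_hitting_set[OF Suc.prems(1-3), of m] Suc.prems(4) by auto
  have "\<exists>X c. X \<subseteq> V - H \<and> (\<forall>Q\<in>quadrants f g. m - 2 \<le> card ((V - H) \<inter> Q) \<longrightarrow> {..<k} \<subseteq> c ` (X \<inter> Q))
    \<and> (\<forall>R. chain_convex f g R \<longrightarrow> m - 2 \<le> card ((V - H) \<inter> R) \<longrightarrow> m - 2 - 2 * k \<le> card ((V - H - X) \<inter> R))"
    using Suc.prems by (intro Suc.IH) (auto intro: inj_on_subset)
  then obtain X c where X: "X \<subseteq> V - H"
    "\<forall>Q\<in>quadrants f g. m - 2 \<le> card ((V - H) \<inter> Q) \<longrightarrow> {..<k} \<subseteq> c ` (X \<inter> Q)"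
    "\<forall>R. chain_convex f g R \<longrightarrow> m - 2 \<le> card ((V - H) \<inter> R) \<longrightarrow> m - 2 - 2 * k \<le> card ((V - H - X) \<inter> R)"
    by blast
  define d where "d v = (if v \<in> H then k else c v)" for v
  have "{..<Suc k} \<subseteq> d ` ((H \<union> X) \<inter> Q)" if Q: "Q \<in> quadrants f g" "m \<le> card (V \<inter> Q)" for Q
  proof -
    have "{..<k} \<subseteq> c ` (X \<inter> Q)" using X(2) H(3) Q chain_convex_quadrant by blast
    moreover have "c ` (X \<inter> Q) = d ` (X \<inter> Q)" using X(1) by (intro image_cong) (auto simp: d_def)
    moreover have "k \<in> d ` (H \<inter> Q)" using H(2) Q by (force simp: d_def)
    ultimately show ?thesis by (auto simp: lessThan_Suc Int_Un_distrib2 image_Un)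
  qed
  moreover have "m - 2 * Suc k \<le> card ((V - (H \<union> X)) \<inter> R)"
    if "chain_convex f g R" "m \<le> card (V \<inter> R)" for R
    using X(3) H(3) that by (simp add: Diff_eq Int_assoc)
  ultimately show ?case using H(1) X(1) by (intro exI[of _ "H \<union> X"] exI[of _ d]) blast
qed auto

text \<open>Colourability is assumed for every subset of \<open>V\<close> because \<R> is coloured
  on whatever points the hitting sets leave over.\<close>

lemma colourable_add_quadrants:
  assumes "finite V" "inj_on f V" "inj_on g V"
    and "\<And>U. U \<subseteq> V \<Longrightarrow> colourable k U \<R> m" and "\<And>R. R \<in> \<R> \<Longrightarrow> chain_convex f g R"
  shows "colourable k V (\<R> \<union> quadrants f g) (m + 2 * k)"
proof -
  obtain X c where X: "X \<subseteq> V"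
    "\<forall>Q\<in>quadrants f g. m + 2 * k \<le> card (V \<inter> Q) \<longrightarrow> {..<k} \<subseteq> c ` (X \<inter> Q)"
    "\<forall>R. chain_convex f g R \<longrightarrow> m + 2 * k \<le> card (V \<inter> R) \<longrightarrow> m \<le> card ((V - X) \<inter> R)"
    using quadrants_partial_colouring[OF assms(1-3), of k "m + 2 * k"] by auto
  obtain d where d: "\<forall>R\<in>\<R>. m \<le> card ((V - X) \<inter> R) \<longrightarrow> {..<k} \<subseteq> d ` ((V - X) \<inter> R)"
    using assms(4)[of "V - X"] by (auto simp: colourable_def)
  define e where "e v = (if v \<in> X then c v else d v)" for v
  have "{..<k} \<subseteq> e ` (V \<inter> R)" if R: "R \<in> \<R> \<union> quadrants f g" "m + 2 * k \<le> card (V \<inter> R)" for R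
  proof (cases "R \<in> quadrants f g")
    case True
    then have "{..<k} \<subseteq> c ` (X \<inter> R)" using X(2) R(2) by blast
    also have "c ` (X \<inter> R) = e ` (X \<inter> R)" by (intro image_cong) (auto simp: e_def)
    also have "\<dots> \<subseteq> e ` (V \<inter> R)" using X(1) by blast
    finally show ?thesis .
  next
    case False
    then have "R \<in> \<R>" using R(1) by blast
    then have "{..<k} \<subseteq> d ` ((V - X) \<inter> R)" using d X(3) R(2) assms(5) by blast
    also have "d ` ((V - X) \<inter> R) = e ` ((V - X) \<inter> R)" by (intro image_cong) (auto simp: e_def)
    also have "\<dots> \<subseteq> e ` (V \<inter> R)" by blast
    finally show ?thesis .
  qed
  then show ?thesis unfolding colourable_def by blast
qed

section \<open>Bottomless rectangles\<close>

definition bottomless :: "('a \<Rightarrow> real) \<Rightarrow> ('a \<Rightarrow> real) \<Rightarrow> 'a set set" where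
  "bottomless f g = {{v. a1 \<le> f v \<and> f v \<le> a2 \<and> g v \<le> b} | a1 a2 b. True}"

lemma obtain_lower_part:
  fixes f :: "'a \<Rightarrow> real"
  assumes "finite W" "inj_on f W" "n \<le> card W"
  obtains A where "A \<subseteq> W" "card A = n" "\<And>u w. u \<in> A \<Longrightarrow> w \<in> W - A \<Longrightarrow> f u < f w"
proof -
  have "\<exists>A\<subseteq>W. card A = n \<and> (\<forall>u\<in>A. \<forall>w\<in>W - A. f u < f w)"
    using assms(3)
  proof (induction n)
    case (Suc n)
    then obtain A where A: "A \<subseteq> W" "card A = n" "\<forall>u\<in>A. \<forall>w\<in>W - A. f u < f w" by auto
    have finA: "finite A" using A(1) assms(1) finite_subset by blast
    have "W - A \<noteq> {}" using A(1,2) Suc.prems by (metis Diff_eq_empty_iff Suc_n_not_le_n subset_antisym)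
    then obtain p where p: "p \<in> W - A" "\<And>x. x \<in> W - A \<Longrightarrow> f p \<le> f x"
      using assms(1) by (metis arg_min_if_finite(1) arg_min_least finite_Diff)
    have "f p < f w" if "w \<in> W - insert p A" for w
      using p(2)[of w] that inj_onD[OF assms(2), of p w] p(1) by (cases "f p = f w") auto
    then show ?case using A p finA by (intro exI[of _ "insert p A"]) auto
  qed auto
  then show thesis using that by blast
qed

text \<open>The points are inserted by increasing \<open>g\<close>. When colour \<open>j\<close> is missing from \<open>3 k - 2\<close> consecutive
  points, each other colour occurs at most once among the middle \<open>k\<close> of them, so one of
  these is still uncoloured and can receive \<open>j\<close> without destroying the separation.\<close>

lemma bottomless_partial_colouring:
  assumes "finite V" "inj_on f V" "0 < k"
  shows "\<exists>X c. X \<subseteq> V \<and> c ` X \<subseteq> {..<k}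
    \<and> (\<forall>R\<in>bottomless f g. 3 * k - 2 \<le> card (V \<inter> R) \<longrightarrow> {..<k} \<subseteq> c ` (X \<inter> R))
    \<and> (\<forall>p\<in>X. \<forall>q\<in>X. c p = c q \<longrightarrow> f p < f q \<longrightarrow> k - 1 \<le> card {v \<in> V. f p < f v \<and> f v < f q})"
  using assms(1,2)
proof (induction V rule: finite_ranking_induct[where f = g])
  case empty
  show ?case using assms(3) by auto
next
  case (insert v V)
  let ?V = "insert v V" and ?m = "3 * k - 2"
  define between where "between p q = {u \<in> ?V. f p < f u \<and> f u < f q}" for p q
  obtain X0 c0 where X0: "X0 \<subseteq> V" "c0 ` X0 \<subseteq> {..<k}"
    "\<forall>R\<in>bottomless f g. ?m \<le> card (V \<inter> R) \<longrightarrow> {..<k} \<subseteq> c0 ` (X0 \<inter> R)"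
    "\<forall>p\<in>X0. \<forall>q\<in>X0. c0 p = c0 q \<longrightarrow> f p < f q \<longrightarrow> k - 1 \<le> card {u \<in> V. f p < f u \<and> f u < f q}"
    using insert.IH insert.prems by (auto simp: inj_on_def)
  have fin: "finite ?V" using insert.hyps by simp
  \<comment> \<open>The point \<open>v\<close> has the largest \<open>g\<close>, so a rectangle
    containing it cuts \<open>?V\<close> as a strip does. It is enough to repair strips, one colour
    \<open>j\<close> after another.\<close>
  have "\<exists>X c. X \<subseteq> ?V \<and> c ` X \<subseteq> {..<k}
    \<and> (\<forall>R\<in>bottomless f g. ?m \<le> card (V \<inter> R) \<longrightarrow> {..<k} \<subseteq> c ` (X \<inter> R))
    \<and> (\<forall>p\<in>X. \<forall>q\<in>X. c p = c q \<longrightarrow> f p < f q \<longrightarrow> k - 1 \<le> card (between p q))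
    \<and> (\<forall>i<j. \<forall>R\<in>strips f. ?m \<le> card (?V \<inter> R) \<longrightarrow> i \<in> c ` (X \<inter> R))"
    if "j \<le> k" for j
    using that
  proof (induction j)
    case 0
    have mono: "card {u \<in> V. f p < f u \<and> f u < f q} \<le> card (between p q)" for p q
      unfolding between_def using fin by (intro card_mono) auto
    have "\<forall>p\<in>X0. \<forall>q\<in>X0. c0 p = c0 q \<longrightarrow> f p < f q \<longrightarrow> k - 1 \<le> card (between p q)"
      using X0(4) order.trans[OF _ mono] by blast
    then show ?case using X0(1-3) by (intro exI[of _ X0] exI[of _ c0]) auto
  next
    case (Suc j)
    then obtain X c where X: "X \<subseteq> ?V" "c ` X \<subseteq> {..<k}"
      and cov: "\<forall>R\<in>bottomless f g. ?m \<le> card (V \<inter> R) \<longrightarrow> {..<k} \<subseteq> c ` (X \<inter> R)"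
      and sep: "\<forall>p\<in>X. \<forall>q\<in>X. c p = c q \<longrightarrow> f p < f q \<longrightarrow> k - 1 \<le> card (between p q)"
      and old: "\<forall>i<j. \<forall>R\<in>strips f. ?m \<le> card (?V \<inter> R) \<longrightarrow> i \<in> c ` (X \<inter> R)"
      by auto
    define bad where "bad R \<longleftrightarrow> R \<in> strips f \<and> ?m \<le> card (?V \<inter> R) \<and> j \<notin> c ` (X \<inter> R)" for R
    show ?case
    proof (cases "\<exists>R. bad R")
      case False
      then have "\<forall>i<Suc j. \<forall>R\<in>strips f. ?m \<le> card (?V \<inter> R) \<longrightarrow> i \<in> c ` (X \<inter> R)"
        using old by (auto simp: bad_def less_Suc_eq)
      then show ?thesis using X cov sep by blast
    next
      case True
      \<comment> \<open>A strip with enough old points, cut off at the level \<open>g v\<close>, is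
        a bottomless rectangle that already sees all colours. A bad strip therefore contains
        \<open>v\<close> and has exactly \<open>?m\<close> points.\<close>
      have Vsmall: "card (V \<inter> R) < ?m" if badR: "bad R" for R
      proof (rule ccontr)
        assume large: "\<not> ?thesis"
        obtain a b where ab: "R = {u. a \<le> f u \<and> f u \<le> b}"
          using badR by (auto simp: bad_def strips_def)
        define R' where "R' = {u. a \<le> f u \<and> f u \<le> b \<and> g u \<le> g v}"
        have "V \<inter> R' = V \<inter> R" using insert.hyps by (auto simp: ab R'_def)
        moreover have "R' \<in> bottomless f g" by (auto simp: R'_def bottomless_def)
        ultimately have "{..<k} \<subseteq> c ` (X \<inter> R')" using cov large by (metis linorder_not_less)
        also have "\<dots> \<subseteq> c ` (X \<inter> R)" by (auto simp: ab R'_def)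
        finally have "j \<in> c ` (X \<inter> R)" using Suc.prems by (simp add: subset_iff)
        then show False using badR by (simp add: bad_def)
      qed
      have bad_v: "v \<in> R" and bad_card: "card (?V \<inter> R) = ?m" if "bad R" for R
      proof -
        show "v \<in> R"
        proof (rule ccontr)
          assume "v \<notin> R"
          then have "?V \<inter> R = V \<inter> R" by auto
          then show False using that Vsmall[OF that] by (simp add: bad_def)
        qed
        then have "card (?V \<inter> R) \<le> Suc (card (V \<inter> R))"
          using card_insert_le_m1 by (simp add: card_insert_if insert.hyps)
        then show "card (?V \<inter> R) = ?m" using that Vsmall[OF that] by (simp add: bad_def)
      qed
      \<comment> \<open>Bad strips share \<open>v\<close>, so the union of two is a strip; it is bad
        as well and has no more points than either of them. All bad strips thus cut out the same
        points, and colouring one more point repairs them all.\<close>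
      have bad_unique: "?V \<inter> R = ?V \<inter> S" if RS: "bad R" "bad S" for R S
      proof -
        obtain a b a' b' where ab: "R = {u. a \<le> f u \<and> f u \<le> b}" "S = {u. a' \<le> f u \<and> f u \<le> b'}"
          using RS by (auto simp: bad_def strips_def)
        have "v \<in> R" "v \<in> S" using bad_v RS by auto
        then have "R \<union> S = {u. min a a' \<le> f u \<and> f u \<le> max b b'}" by (auto simp: ab)
        then have "R \<union> S \<in> strips f" by (auto simp: strips_def)
        moreover have "card (?V \<inter> R) \<le> card (?V \<inter> (R \<union> S))" using fin by (intro card_mono) auto
        moreover have "j \<notin> c ` (X \<inter> (R \<union> S))" using RS by (auto simp: bad_def)
        ultimately have "bad (R \<union> S)" using RS(1) by (simp add: bad_def)
        then have union: "card (?V \<inter> (R \<union> S)) = ?m" by (rule bad_card)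
        have "?V \<inter> R = ?V \<inter> (R \<union> S)"
          by (rule card_subset_eq) (use union bad_card[OF RS(1)] fin in auto)
        moreover have "?V \<inter> S = ?V \<inter> (R \<union> S)"
          by (rule card_subset_eq) (use union bad_card[OF RS(2)] fin in auto)
        ultimately show ?thesis by simp
      qed
      obtain R where R: "bad R" using True by blast
      define W where "W = ?V \<inter> R"
      obtain a b where ab: "R = {u. a \<le> f u \<and> f u \<le> b}" using R by (auto simp: bad_def strips_def)
      have W: "finite W" "inj_on f W" "card W = ?m" "W \<subseteq> ?V"
        using fin bad_card[OF R] insert.prems by (auto simp: W_def intro: inj_on_subset)
      have "k - 1 \<le> card W" using W(3) assms(3) by linarith
      \<comment> \<open>The window splits as (k - 1) + k + (k - 1) = 3k - 2. The flanks
        \<open>A\<close> and \<open>B\<close> separate any point of the middle part from points of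
        colour \<open>j\<close> outside the strip.\<close>
      then obtain A where A: "A \<subseteq> W" "card A = k - 1" "\<And>u w. u \<in> A \<Longrightarrow> w \<in> W - A \<Longrightarrow> f u < f w"
        using obtain_lower_part[OF W(1,2)] by blast
      have cWA: "card (W - A) = 2 * k - 1"
        using A(1,2) W(1,3) assms(3) by (simp add: card_Diff_subset finite_subset)
      have "finite (W - A)" "inj_on (\<lambda>u. - f u) (W - A)" "k - 1 \<le> card (W - A)"
        using W(1,2) cWA by (auto simp: inj_on_def)
      then obtain B where B: "B \<subseteq> W - A" "card B = k - 1"
        "\<And>u w. u \<in> B \<Longrightarrow> w \<in> W - A - B \<Longrightarrow> - f u < - f w"
        using obtain_lower_part[of "W - A" "\<lambda>u. - f u"] by blast
      define M where "M = W - A - B"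
      have cM: "card M = k" "finite M"
        using B(1,2) W(1) cWA assms(3) by (auto simp: M_def card_Diff_subset finite_subset)
      have btw: "between p q \<subseteq> M" if "p \<in> M" "q \<in> M" for p q
      proof
        fix u assume u: "u \<in> between p q"
        then have uW: "u \<in> W" using that by (auto simp: between_def M_def W_def ab)
        moreover have "u \<notin> A" using A(3)[of u p] u that by (auto simp: between_def M_def)
        moreover have "u \<notin> B" using B(3)[of u q] u that by (auto simp: between_def M_def)
        ultimately show "u \<in> M" by (simp add: M_def)
      qed
      have "\<not> M \<subseteq> X"
      proof
        assume MX: "M \<subseteq> X"
        have neq: "c p \<noteq> c q" if pq: "p \<in> M" "q \<in> M" "f p < f q" for p q
        proof
          assume "c p = c q"
          then have "k - 1 \<le> card (between p q)" using sep pq MX by blast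
          moreover have "card (between p q) \<le> card (M - {p, q})"
            using btw[OF pq(1,2)] cM(2) by (intro card_mono) (auto simp: between_def)
          moreover have "card (M - {p, q}) + 2 = k"
          proof -
            have "p \<noteq> q" using pq(3) by auto
            then have "card {p, q} = 2" by simp
            then show ?thesis
              using pq cM card_Diff_subset[of "{p, q}" M] card_mono[of M "{p, q}"] by auto
          qed
          ultimately show False by linarith
        qed
        have "inj_on c M"
        proof (rule inj_onI)
          fix p q assume pq: "p \<in> M" "q \<in> M" "c p = c q"
          then have "f p = f q" using neq[of p q] neq[of q p] by force
          then show "p = q" using W(2) pq(1,2) by (auto simp: M_def dest: inj_onD)
        qed
        then have "card (c ` M) = k" using cM(1) by (simp add: card_image)
        moreover have "c ` M \<subseteq> {..<k} - {j}"
          using MX X(2) R by (auto simp: bad_def M_def W_def)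
        ultimately have "k \<le> card ({..<k} - {j})" using card_mono[of "{..<k} - {j}"] by force
        then show False using Suc.prems by simp
      qed
      then obtain p where p: "p \<in> M" "p \<notin> X" by blast
      define X' where "X' = insert p X"
      define c' where "c' = c(p := j)"
      have pW: "p \<in> W" using p(1) by (simp add: M_def)
      have image: "c ` (X \<inter> S) \<subseteq> c' ` (X' \<inter> S)" for S
        using p(2) by (force simp: c'_def X'_def)
      have far: "k - 1 \<le> card (between q p)" if q: "q \<in> X" "c q = j" "f q < f p" for q
      proof -
        have "q \<notin> R" using R q by (auto simp: bad_def)
        then have "f q < a" using q(3) pW by (auto simp: W_def ab)
        then have "A \<subseteq> between q p"
          using A(1) A(3)[of _ p] p(1) by (force simp: between_def M_def W_def ab)
        then show ?thesis using card_mono[of "between q p" A] A(2) fin by (simp add: between_def)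
      qed
      have far': "k - 1 \<le> card (between p q)" if q: "q \<in> X" "c q = j" "f p < f q" for q
      proof -
        have "q \<notin> R" using R q by (auto simp: bad_def)
        then have "b < f q" using q(3) pW by (auto simp: W_def ab)
        then have "B \<subseteq> between p q"
          using B(1) B(3)[of _ p] p(1) by (force simp: between_def M_def W_def ab)
        then show ?thesis using card_mono[of "between p q" B] B(2) fin by (simp add: between_def)
      qed
      have "X' \<subseteq> ?V" "c' ` X' \<subseteq> {..<k}"
        using X pW W(4) Suc.prems by (auto simp: X'_def c'_def)
      moreover have "\<forall>S\<in>bottomless f g. ?m \<le> card (V \<inter> S) \<longrightarrow> {..<k} \<subseteq> c' ` (X' \<inter> S)"
        using cov image by (meson order.trans)
      moreover have "\<forall>q\<in>X'. \<forall>r\<in>X'. c' q = c' r \<longrightarrow> f q < f r \<longrightarrow> k - 1 \<le> card (between q r)"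
        using sep far far' p(2) by (auto simp: X'_def c'_def)
      moreover have "\<forall>i<Suc j. \<forall>S\<in>strips f. ?m \<le> card (?V \<inter> S) \<longrightarrow> i \<in> c' ` (X' \<inter> S)"
      proof (intro allI impI ballI)
        fix i S assume i: "i < Suc j" and S: "S \<in> strips f" "?m \<le> card (?V \<inter> S)"
        show "i \<in> c' ` (X' \<inter> S)"
        proof (cases "bad S \<and> i = j")
          case True
          then have "p \<in> S" using bad_unique[OF R, of S] pW by (auto simp: W_def)
          then show ?thesis using True by (force simp: c'_def X'_def)
        next
          case False
          then have "i \<in> c ` (X \<inter> S)" using i S old by (auto simp: bad_def less_Suc_eq)
          then show ?thesis using image by blast
        qed
      qed
      ultimately show ?thesis by blast
    qed
  qed
  from this[OF order_refl] obtain X c where X: "X \<subseteq> ?V" "c ` X \<subseteq> {..<k}"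
    "\<forall>R\<in>bottomless f g. ?m \<le> card (V \<inter> R) \<longrightarrow> {..<k} \<subseteq> c ` (X \<inter> R)"
    "\<forall>p\<in>X. \<forall>q\<in>X. c p = c q \<longrightarrow> f p < f q \<longrightarrow> k - 1 \<le> card (between p q)"
    "\<forall>i<k. \<forall>R\<in>strips f. ?m \<le> card (?V \<inter> R) \<longrightarrow> i \<in> c ` (X \<inter> R)"
    by (elim exE conjE)
  have cov: "{..<k} \<subseteq> c ` (X \<inter> R)" if R: "R \<in> bottomless f g" "?m \<le> card (?V \<inter> R)" for R
  proof (cases "v \<in> R")
    case True
    obtain a1 a2 b where ab: "R = {u. a1 \<le> f u \<and> f u \<le> a2 \<and> g u \<le> b}"
      using R(1) by (auto simp: bottomless_def)
    define S where "S = {u. a1 \<le> f u \<and> f u \<le> a2}"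
    have VS: "?V \<inter> R = ?V \<inter> S" using True insert.hyps by (force simp: ab S_def)
    have "S \<in> strips f" by (auto simp: S_def strips_def)
    then have "{..<k} \<subseteq> c ` (X \<inter> S)" using X(5) R(2) VS by auto
    moreover have "X \<inter> S = X \<inter> R" using VS X(1) by blast
    ultimately show ?thesis by simp
  next
    case False
    then have "?V \<inter> R = V \<inter> R" by auto
    then show ?thesis using X(3) R by simp
  qed
  show ?case
    using X(1,2,4) cov unfolding between_def by (intro exI[of _ X] exI[of _ c] conjI ballI impI) auto
qed

lemma colourable_bottomless:
  assumes "finite V" "inj_on f V" "0 < k"
  shows "colourable k V (bottomless f g) (3 * k - 2)"
proof -
  obtain X c where "X \<subseteq> V"
    "\<forall>R\<in>bottomless f g. 3 * k - 2 \<le> card (V \<inter> R) \<longrightarrow> {..<k} \<subseteq> c ` (X \<inter> R)"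
    using bottomless_partial_colouring[OF assms, of g] by blast
  then show ?thesis unfolding colourable_def
    by (metis Int_mono image_mono order_refl subset_trans)
qed

section \<open>Quadrants together with bottomless rectangles\<close>

text \<open>The points arrive by decreasing \<open>g\<close>, and \<open>P\<close> is the set of the \<open>m\<close> points with least \<open>f\<close> seen so
  far; it always carries each of the \<open>k\<close> colours exactly once. When a coloured point \<open>q\<close> is pushed
  out of \<open>P\<close>, its colour passes to the leftmost uncoloured point \<open>p\<close> of \<open>P\<close>. All uncoloured points
  of \<open>P\<close> then lie to the right of \<open>p\<close>, to the left of \<open>q\<close> and below \<open>q\<close>, hence in every bottomless
  rectangle containing both \<open>p\<close> and \<open>q\<close>. The set \<open>Z\<close> consists of the \<open>k\<close> points coloured at the
  start. No other point is coloured before \<open>2 m + 1 - k\<close> points have arrived, and by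
  then the sweeps from the left and from the right hardly interact any more.\<close>

definition late_quadrant where
  "late_quadrant f g k m V X Q \<longleftrightarrow> (\<exists>w\<in>V. \<exists>a. Q = {u \<in> V. f u \<le> (a::real) \<and> (g w :: real) \<le> g u}
     \<and> card Q = m \<and> card (Q \<inter> X) = k \<and> 2 * m + 1 - k \<le> card {u \<in> V. g w \<le> g u})"

text \<open>Time is encoded by levels: the points \<open>u\<close> with \<open>g w \<le> g u\<close>
  are those that have arrived up to \<open>w\<close>. The clause on rectangles bounds the cost:
  either the coloured points of a rectangle have distinct colours, or the rectangle contains the
  \<open>m - k\<close> uncoloured points of a late quadrant. The last clause remembers a moment when
  few points lay to the left of \<open>p\<close>; it serves to compare opposite sweeps.\<close>

definition sweep_good where
  "sweep_good f g k m V X Z c \<longleftrightarrow> X \<subseteq> V \<and> c ` X \<subseteq> {..<k} \<and> Z \<subseteq> X \<and> card Z \<le> k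
    \<and> (\<forall>w\<in>V. \<forall>a. card {u \<in> V. f u \<le> (a::real) \<and> (g w :: real) \<le> g u} = m
         \<longrightarrow> {..<k} \<subseteq> c ` ({u \<in> V. f u \<le> a \<and> g w \<le> g u} \<inter> X))
    \<and> (\<forall>R\<in>bottomless f g. \<forall>p\<in>X \<inter> R. \<forall>q\<in>X \<inter> R. p \<noteq> q \<longrightarrow> c p = c q
         \<longrightarrow> (\<exists>Q. late_quadrant f g k m V X Q \<and> Q - X \<subseteq> R))
    \<and> (\<forall>p\<in>X. \<exists>w\<in>V. g w \<le> g p \<and> m \<le> card {u \<in> V. g w \<le> g u}
         \<and> card {u \<in> V. g w \<le> g u \<and> f u < f p} < k
         \<and> (p \<in> Z \<or> 2 * m + 1 - k \<le> card {u \<in> V. g w \<le> g u}))"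

text \<open>The last clause is a clock. A start point has fewer than \<open>k\<close> points on its
  left at first, and each arrival adds at most one. It is pushed out only as the rightmost of the
  \<open>m\<close> points of \<open>P\<close>, with \<open>m - 1\<close> points on its left, which
  forces \<open>2 * m + 1 - k\<close> arrivals, the current one included.\<close>

definition sweep_inv where
  "sweep_inv f g k m V P X Z c \<longleftrightarrow> P \<subseteq> V \<and> card P = m \<and> (\<forall>u\<in>P. \<forall>w\<in>V - P. f u < (f w :: real))
    \<and> card (P \<inter> X) = k \<and> inj_on c (P \<inter> X)
    \<and> (\<forall>q\<in>P \<inter> X. \<forall>u\<in>P - X. f u < f q \<longrightarrow> (g u :: real) < g q)
    \<and> (\<forall>p\<in>X. \<forall>q\<in>X. p \<noteq> q \<longrightarrow> c p = c q \<longrightarrow> (\<forall>u\<in>P. f u < max (f p) (f q))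
         \<and> (\<forall>u\<in>P - X. g u < max (g p) (g q)) \<and> (f p < f q \<longrightarrow> g p < g q))
    \<and> (X = Z \<and> (\<forall>q\<in>Z. card {u \<in> V. f u < f q} < k + (card V - m)) \<or> 2 * m + 1 - k \<le> card V)"

lemma lower_parts_eq:
  fixes f :: "'a \<Rightarrow> real"
  assumes "finite V" "P \<subseteq> V" "\<And>u w. u \<in> P \<Longrightarrow> w \<in> V - P \<Longrightarrow> f u < f w"
    and "card {u \<in> V. f u \<le> a} = card P"
  shows "{u \<in> V. f u \<le> a} = P"
proof (cases "P \<subseteq> {u \<in> V. f u \<le> a}")
  case True
  then show ?thesis using assms(1,4) by (metis (no_types, lifting) card_subset_eq finite_Collect_conjI finite_subset mem_Collect_eq subsetI)
next
  case False
  then have "{u \<in> V. f u \<le> a} \<subseteq> P" using assms(2,3) by force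
  then show ?thesis using assms(1,2,4) by (metis card_subset_eq finite_subset)
qed

text \<open>The newcomer has the least \<open>g\<close>, so quadrants at older levels do not change.
  New are only the quadrant cut out at level \<open>g v\<close>, which must be \<open>P\<close>, and
  the rectangles that contain a newly coloured point.\<close>

lemma sweep_good_insert:
  assumes V: "finite V" "v \<notin> V" "\<And>u. u \<in> V \<Longrightarrow> g v < g u"
    and good: "sweep_good f g k m V X Z c"
    and P: "P \<subseteq> insert v V" "card P = m" "\<And>u w. u \<in> P \<Longrightarrow> w \<in> insert v V - P \<Longrightarrow> f u < f w"
    and X': "X \<subseteq> X'" "X' \<subseteq> insert v V" "d ` X' \<subseteq> {..<k}" "\<And>u. u \<in> X \<Longrightarrow> d u = c u"
    and col: "{..<k} \<subseteq> d ` (P \<inter> X')"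
    and pairs: "\<And>R p q. R \<in> bottomless f g \<Longrightarrow> p \<in> X' \<inter> R \<Longrightarrow> q \<in> X' \<inter> R \<Longrightarrow> p \<noteq> q \<Longrightarrow> d p = d q
      \<Longrightarrow> X' \<inter> R = X \<inter> R \<or> (\<exists>Q. late_quadrant f g k m (insert v V) X' Q \<and> Q - X' \<subseteq> R)"
    and new: "\<And>p. p \<in> X' - X \<Longrightarrow> card {u \<in> insert v V. f u < f p} < k \<and> 2 * m + 1 - k \<le> card (insert v V)"
  shows "sweep_good f g k m (insert v V) X' Z d"
proof -
  let ?V = "insert v V"
  have X: "X \<subseteq> V" "Z \<subseteq> X" "card Z \<le> k" using good by (auto simp: sweep_good_def)
  have Ga: "\<forall>w\<in>V. \<forall>a. card {u \<in> V. f u \<le> a \<and> g w \<le> g u} = m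
      \<longrightarrow> {..<k} \<subseteq> c ` ({u \<in> V. f u \<le> a \<and> g w \<le> g u} \<inter> X)"
    using good unfolding sweep_good_def by (elim conjE)
  have Gb: "\<forall>R\<in>bottomless f g. \<forall>p\<in>X \<inter> R. \<forall>q\<in>X \<inter> R. p \<noteq> q \<longrightarrow> c p = c q
      \<longrightarrow> (\<exists>Q. late_quadrant f g k m V X Q \<and> Q - X \<subseteq> R)"
    using good unfolding sweep_good_def by (elim conjE)
  have Ge: "\<forall>p\<in>X. \<exists>w\<in>V. g w \<le> g p \<and> m \<le> card {u \<in> V. g w \<le> g u}
      \<and> card {u \<in> V. g w \<le> g u \<and> f u < f p} < k
      \<and> (p \<in> Z \<or> 2 * m + 1 - k \<le> card {u \<in> V. g w \<le> g u})"
    using good unfolding sweep_good_def by (elim conjE)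
  have lev: "{u \<in> ?V. g w \<le> g u} = {u \<in> V. g w \<le> g u}" if "w \<in> V" for w
    using V(3)[OF that] by auto
  have lev2: "{u \<in> ?V. h u \<and> g w \<le> g u} = {u \<in> V. h u \<and> g w \<le> g u}" if "w \<in> V" for h w
    using V(3)[OF that] by auto
  have lev3: "{u \<in> ?V. g w \<le> g u \<and> h u} = {u \<in> V. g w \<le> g u \<and> h u}" if "w \<in> V" for h w
    using V(3)[OF that] by auto
  have levv: "{u \<in> ?V. g v \<le> g u} = ?V" "{u \<in> ?V. h u \<and> g v \<le> g u} = {u \<in> ?V. h u}"
    "{u \<in> ?V. g v \<le> g u \<and> h u} = {u \<in> ?V. h u}" for h
    using V(3) by (auto simp: less_imp_le)
  have a: "{..<k} \<subseteq> d ` ({u \<in> ?V. f u \<le> a \<and> g w \<le> g u} \<inter> X')"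
    if w: "w \<in> ?V" "card {u \<in> ?V. f u \<le> a \<and> g w \<le> g u} = m" for w a
  proof (cases "w = v")
    case True
    have "{u \<in> ?V. f u \<le> a} = P"
      by (rule lower_parts_eq) (use V(1) P w True levv in auto)
    then show ?thesis using col True levv(2)[of "\<lambda>u. f u \<le> a"] by simp
  next
    case False
    then have wV: "w \<in> V" using w(1) by simp
    let ?Q = "{u \<in> V. f u \<le> a \<and> g w \<le> g u}"
    have "{..<k} \<subseteq> c ` (?Q \<inter> X)"
      using w(2) unfolding lev2[OF wV, of "\<lambda>u. f u \<le> a"] by (rule Ga[rule_format, OF wV])
    also have "c ` (?Q \<inter> X) = d ` (?Q \<inter> X)" using X'(4) by (intro image_cong) auto
    also have "\<dots> \<subseteq> d ` (?Q \<inter> X')" using X'(1) by blast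
    finally show ?thesis unfolding lev2[OF wV, of "\<lambda>u. f u \<le> a"] .
  qed
  have late: "late_quadrant f g k m ?V X' Q" if Q: "late_quadrant f g k m V X Q" "Q \<inter> X' = Q \<inter> X" for Q
  proof -
    obtain w a where wa: "w \<in> V" "Q = {u \<in> V. f u \<le> a \<and> g w \<le> g u}" "card Q = m" "card (Q \<inter> X) = k"
      "2 * m + 1 - k \<le> card {u \<in> V. g w \<le> g u}"
      using Q(1) unfolding late_quadrant_def by (elim bexE exE conjE)
    then show ?thesis unfolding late_quadrant_def
      using lev[OF wa(1)] lev2[OF wa(1), of "\<lambda>u. f u \<le> a"] Q(2) by (intro bexI[of _ w] exI[of _ a]) auto
  qed
  have b: "\<exists>Q. late_quadrant f g k m ?V X' Q \<and> Q - X' \<subseteq> R"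
    if R: "R \<in> bottomless f g" "p \<in> X' \<inter> R" "q \<in> X' \<inter> R" "p \<noteq> q" "d p = d q" for R p q
  proof (cases "X' \<inter> R = X \<inter> R")
    case True
    then have "p \<in> X \<inter> R" "q \<in> X \<inter> R" "c p = c q" using R X'(4) by auto
    then obtain Q where Q: "late_quadrant f g k m V X Q" "Q - X \<subseteq> R" using Gb R(1,4) by blast
    \<comment> \<open>A newly coloured point of \<open>Q\<close> would lie in \<open>R\<close>,
      because \<open>Q - X \<subseteq> R\<close>; but \<open>R\<close> has none.\<close>
    have "Q \<inter> X' = Q \<inter> X" using True Q(2) X'(1) by blast
    then show ?thesis using late[OF Q(1)] Q(2) by blast
  next
    case False
    then show ?thesis using pairs[OF R] by blast
  qed
  have e: "\<exists>w\<in>?V. g w \<le> g p \<and> m \<le> card {u \<in> ?V. g w \<le> g u}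
         \<and> card {u \<in> ?V. g w \<le> g u \<and> f u < f p} < k
         \<and> (p \<in> Z \<or> 2 * m + 1 - k \<le> card {u \<in> ?V. g w \<le> g u})" if p: "p \<in> X'" for p
  proof (cases "p \<in> X")
    case True
    obtain w where w: "w \<in> V" "g w \<le> g p" "m \<le> card {u \<in> V. g w \<le> g u}"
         "card {u \<in> V. g w \<le> g u \<and> f u < f p} < k"
         "p \<in> Z \<or> 2 * m + 1 - k \<le> card {u \<in> V. g w \<le> g u}"
      using bspec[OF Ge True] by (elim bexE conjE)
    then show ?thesis using lev[OF w(1)] lev3[OF w(1), of "\<lambda>u. f u < f p"]
      by (intro bexI[of _ w]) auto
  next
    case False
    have "m \<le> card ?V" using card_mono[OF _ P(1)] P(2) V(1) by simp
    moreover have "g v \<le> g p" using p X'(2) V(3) by (auto simp: less_imp_le)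
    ultimately show ?thesis using new[of p] p False levv(1) levv(3)[of "\<lambda>u. f u < f p"]
      by (intro bexI[of _ v]) auto
  qed
  show ?thesis unfolding sweep_good_def
  proof (intro conjI ballI allI impI)
    show "Z \<subseteq> X'" using X(2) X'(1) by blast
  qed (fact X X' a b e)+
qed

lemma sweep_step:
  assumes V: "finite V" "v \<notin> V" "\<And>u. u \<in> V \<Longrightarrow> g v < g u" and f: "inj_on f (insert v V)"
    and km: "0 < k" "k \<le> m"
    and good: "sweep_good f g k m V X Z c" and inv: "sweep_inv f g k m V P X Z c"
  shows "\<exists>P X Z c. sweep_good f g k m (insert v V) X Z c \<and> sweep_inv f g k m (insert v V) P X Z c"
proof -
  let ?V = "insert v V"
  have X: "X \<subseteq> V" "c ` X \<subseteq> {..<k}" "Z \<subseteq> X" using good by (auto simp: sweep_good_def)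
  have P: "P \<subseteq> V" "card P = m" "\<forall>u\<in>P. \<forall>w\<in>V - P. f u < f w"
    and PX: "card (P \<inter> X) = k" "inj_on c (P \<inter> X)"
    and left: "\<forall>q\<in>P \<inter> X. \<forall>u\<in>P - X. f u < f q \<longrightarrow> g u < g q"
    and pair: "\<forall>p\<in>X. \<forall>q\<in>X. p \<noteq> q \<longrightarrow> c p = c q \<longrightarrow> (\<forall>u\<in>P. f u < max (f p) (f q))
         \<and> (\<forall>u\<in>P - X. g u < max (g p) (g q)) \<and> (f p < f q \<longrightarrow> g p < g q)"
    and time: "X = Z \<and> (\<forall>q\<in>Z. card {u \<in> V. f u < f q} < k + (card V - m)) \<or> 2 * m + 1 - k \<le> card V"
    using inv unfolding sweep_inv_def by - (elim conjE, assumption)+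
  have finP: "finite P" using P(1) V(1) finite_subset by blast
  have mV: "m \<le> card V" using card_mono[OF V(1) P(1)] P(2) by simp
  have "P \<noteq> {}" using P(2) km by auto
  then have "Max (f ` P) \<in> f ` P" using finP by (intro Max_in) auto
  then obtain d where d: "d \<in> P" "\<And>u. u \<in> P \<Longrightarrow> f u \<le> f d"
    using finP by (metis (no_types, lifting) Max_ge finite_imageI image_eqI imageE)
  have dmax: "f u < f d" if "u \<in> P" "u \<noteq> d" for u
    using d(2)[OF that(1)] inj_onD[OF f, of u d] that d(1) P(1) by (cases "f u = f d") auto
  have fvd: "f v \<noteq> f d" using inj_onD[OF f, of v d] d(1) P(1) V(2) by auto
  define P' where "P' = (if f v < f d then insert v P - {d} else P)"
  have P'V: "P' \<subseteq> ?V" "P' \<subseteq> insert v P" "finite P'" using P(1) finP by (auto simp: P'_def)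
  have "v \<notin> P" using P(1) V(2) by blast
  then have cP': "card P' = m" using P(2) finP d(1) by (auto simp: P'_def)
  have low: "f u < f w" if uw: "u \<in> P'" "w \<in> ?V - P'" for u w
  proof (cases "f v < f d")
    case True
    have u: "u = v \<or> u \<in> P \<and> u \<noteq> d" using uw(1) True by (auto simp: P'_def)
    have "w = d \<or> w \<in> V - P" using uw(2) True by (auto simp: P'_def)
    moreover have "f u < f d" using u True dmax by blast
    moreover have "f d < f x" if "x \<in> V - P" for x using P(3) d(1) that by blast
    ultimately show ?thesis by fastforce
  next
    case False
    then have w: "w = v \<or> w \<in> V - P" and u: "u \<in> P" using uw by (auto simp: P'_def)
    have "f u < f v" using d(2)[OF u] False fvd by simp
    then show ?thesis using w u P(3) by blast
  qed
  have le_d: "f u \<le> f d" if "u \<in> P'" for u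
    using that d(2) by (auto simp: P'_def split: if_splits)
  have pair': "(\<forall>u\<in>P'. f u < max (f p) (f q)) \<and> (\<forall>u\<in>P' - X. g u < max (g p) (g q)) \<and> (f p < f q \<longrightarrow> g p < g q)"
    if pq: "p \<in> X" "q \<in> X" "p \<noteq> q" "c p = c q" for p q
  proof -
    note pp = pair[rule_format, OF pq]
    have "f d < max (f p) (f q)" using pp d(1) by blast
    then have "\<forall>u\<in>P'. f u < max (f p) (f q)" using le_d by (meson order_le_less_trans)
    moreover have "g v < max (g p) (g q)" using V(3)[of p] pq(1) X(1) by auto
    then have "\<forall>u\<in>P' - X. g u < max (g p) (g q)" using pp P'V(2) by blast
    ultimately show ?thesis using pp by blast
  qed
  show ?thesis
  \<comment> \<open>The newcomer is uncoloured, so the coloured part of \<open>P\<close> changes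
    only when a coloured \<open>d\<close> is pushed out.\<close>
  proof (cases "P' \<inter> X = P \<inter> X")
    case True
    have "c ` (P' \<inter> X) = {..<k}"
      using PX X(2) True by (intro card_subset_eq) (auto simp: card_image)
    then have "sweep_good f g k m ?V X Z c"
      using X by (intro sweep_good_insert[OF V good P'V(1) cP' low]) auto
    moreover have "sweep_inv f g k m ?V P' X Z c" unfolding sweep_inv_def
    proof (intro conjI ballI impI)
      show "f u < f w" if "u \<in> P'" "w \<in> ?V - P'" for u w by (rule low[OF that])
      show "g u < g q" if "q \<in> P' \<inter> X" "u \<in> P' - X" "f u < f q" for q u
        using left True that P'V(2) V(3) X(1) by blast
      show "X = Z \<and> (\<forall>q\<in>Z. card {u \<in> ?V. f u < f q} < k + (card ?V - m)) \<or> 2 * m + 1 - k \<le> card ?V"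
      proof (cases "2 * m + 1 - k \<le> card V")
        case False
        have "card {u \<in> ?V. f u < f q} < k + (card ?V - m)" if "q \<in> Z" for q
        proof -
          have "card {u \<in> ?V. f u < f q} \<le> card (insert v {u \<in> V. f u < f q})"
            using V(1) by (intro card_mono) auto
          also have "\<dots> \<le> Suc (card {u \<in> V. f u < f q})" using V(1) by (simp add: card_insert_if)
          finally show ?thesis using time False that mV V(1,2) by fastforce
        qed
        then show ?thesis using time False by blast
      qed (use V in auto)
    qed (use P'V cP' PX True pair' in auto)
    ultimately show ?thesis by blast
  next
    case False
    then have fv: "f v < f d" by (auto simp: P'_def split: if_splits)
    then have P': "P' = insert v P - {d}" by (simp add: P'_def)
    have vX: "v \<notin> X" using X(1) V(2) by blast
    have dX: "d \<in> X" using False P' vX by auto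
    have P'X: "P' \<inter> X = P \<inter> X - {d}" using P' vX by auto
    have cP'X: "card (P' \<inter> X) = k - 1" using P'X PX(1) d(1) dX by simp
    have "card (P' - X) = m - (k - 1)"
      using cP' cP'X card_Diff_subset_Int[of P' X] P'V(3) by simp
    then have "0 < card (P' - X)" using km by linarith
    then have "P' - X \<noteq> {}" by (metis card.empty less_irrefl)
    then obtain p where p: "p \<in> P' - X" "\<And>u. u \<in> P' - X \<Longrightarrow> f p \<le> f u"
      using P'V(3) by (metis arg_min_if_finite(1) arg_min_least finite_Diff)
    define X' where "X' = insert p X"
    define c' where "c' = c(p := c d)"
    have c'X: "c' u = c u" if "u \<in> X" for u using that p(1) by (auto simp: c'_def)
    have late: "2 * m + 1 - k \<le> card ?V"
    proof (cases "2 * m + 1 - k \<le> card V")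
      case False
      then have "card {u \<in> V. f u < f d} < k + (card V - m)" using time dX by blast
      moreover have "card (P - {d}) \<le> card {u \<in> V. f u < f d}"
        using dmax P(1) V(1) by (intro card_mono) auto
      ultimately show ?thesis using P(2) d(1) mV V(1,2) by simp
    qed (use V in auto)
    have lft: "f u < f d \<and> g u < g d" if u: "u \<in> P' - X" for u
    proof (cases "u = v")
      case True
      then show ?thesis using fv V(3)[of d] d(1) P(1) by auto
    next
      case False
      then have "u \<in> P - X" "u \<noteq> d" using u P' by auto
      then show ?thesis using dmax left d(1) dX by blast
    qed
    \<comment> \<open>The right-hand point of an equally coloured pair lies beyond all of
      \<open>P\<close>, and \<open>d\<close> is in \<open>P\<close>; so \<open>d\<close> is leftmost
      and lowest in its colour class, and \<open>p\<close> will extend the class further to the left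
      and down.\<close>
    have dq: "f d < f q \<and> g d < g q" if q: "q \<in> X" "q \<noteq> d" "c q = c d" for q
      using pair[rule_format, OF dX q(1)] q d(1) by force
    have pair2: "(\<forall>u\<in>P'. f u < max (f r) (f q)) \<and> (\<forall>u\<in>P' - X'. g u < max (g r) (g q)) \<and> (f r < f q \<longrightarrow> g r < g q)"
      if rq: "r \<in> X'" "q \<in> X'" "r \<noteq> q" "c' r = c' q" for r q
    proof -
      have ge: "f d \<le> f q \<and> g d \<le> g q" if "q \<in> X" "c q = c d" for q
        using dq[of q] that by (cases "q = d") auto
      have P'd: "f u < f d" if "u \<in> P'" for u
        using that dmax fv P' by auto
      consider "r \<in> X" "q \<in> X" | "r = p" "q \<in> X" "c q = c d" | "q = p" "r \<in> X" "c r = c d"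
        using rq p(1) by (auto simp: X'_def c'_def split: if_splits)
      then show ?thesis
      proof cases
        case 1
        then show ?thesis using pair'[of r q] rq(3,4) c'X by (auto simp: X'_def)
      next
        case 2
        then show ?thesis using ge[of q] P'd lft lft[OF p(1)] by (fastforce simp: X'_def less_max_iff_disj)
      next
        case 3
        then show ?thesis using ge[of r] P'd lft lft[OF p(1)] by (fastforce simp: X'_def less_max_iff_disj)
      qed
    qed
    have P'X': "P' \<inter> X' = insert p (P \<inter> X - {d})" using P'X p(1) by (auto simp: X'_def)
    have finPX: "finite (P \<inter> X)" using finP by blast
    have cP'X': "card (P' \<inter> X') = k"
      using PX(1) p(1) d(1) dX km finPX unfolding P'X' by (subst card_insert_disjoint) auto
    have inj: "inj_on c' (P' \<inter> X')"
      unfolding P'X'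
    proof (rule inj_onI)
      fix x y assume "x \<in> insert p (P \<inter> X - {d})" "y \<in> insert p (P \<inter> X - {d})" "c' x = c' y"
      then show "x = y" using p(1) PX(2) d(1) dX
        by (auto simp: c'_def inj_on_def split: if_splits)
    qed
    have c'k: "c' ` X' \<subseteq> {..<k}" using X(2) dX by (auto simp: X'_def c'_def)
    have sg: "sweep_good f g k m ?V X' Z c'"
    proof (rule sweep_good_insert[OF V good P'V(1) cP' low])
      have "c' ` (P' \<inter> X') = {..<k}"
        using inj cP'X' c'k by (intro card_subset_eq) (auto simp: card_image)
      then show "{..<k} \<subseteq> c' ` (P' \<inter> X')" by simp
      show "X' \<subseteq> ?V" using X(1) p(1) P'V(1) by (auto simp: X'_def)
      show "X' \<inter> R = X \<inter> R \<or> (\<exists>Q. late_quadrant f g k m ?V X' Q \<and> Q - X' \<subseteq> R)"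
        if R: "R \<in> bottomless f g" and rq: "r \<in> X' \<inter> R" "q \<in> X' \<inter> R" "r \<noteq> q" "c' r = c' q" for R r q
      proof (cases "p \<in> R")
        case True
        \<comment> \<open>\<open>P'\<close> itself is the late quadrant asked for, with its corner
          at the largest \<open>f\<close> in \<open>P'\<close> and the level
          \<open>g v\<close>.\<close>
        have "finite P'" "P' \<noteq> {}" using P'V(3) p(1) by auto
        then have "Max (f ` P') \<in> f ` P'" by (intro Max_in) auto
        moreover have "{u \<in> ?V. f u \<le> Max (f ` P')} = P'"
        proof
          show "P' \<subseteq> {u \<in> ?V. f u \<le> Max (f ` P')}" using P'V by auto
          show "{u \<in> ?V. f u \<le> Max (f ` P')} \<subseteq> P'"
            using calculation low by force
        qed
        moreover have vlow: "{u \<in> ?V. h u \<and> g v \<le> g u} = {u \<in> ?V. h u}" "{u \<in> ?V. g v \<le> g u} = ?V" for h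
          using V(3) by (auto simp: less_imp_le)
        ultimately have "late_quadrant f g k m ?V X' P'" unfolding late_quadrant_def
          using cP' cP'X' late vlow(1)[of "\<lambda>u. f u \<le> Max (f ` P')"]
          by (intro bexI[of _ v] exI[of _ "Max (f ` P')"]) auto
        moreover have "P' - X' \<subseteq> R"
        proof
          fix u assume u: "u \<in> P' - X'"
          obtain a1 a2 b where ab: "R = {u. a1 \<le> f u \<and> f u \<le> a2 \<and> g u \<le> b}"
            using R by (auto simp: bottomless_def)
          have "f p \<le> f u" using p(2)[of u] u by (auto simp: X'_def)
          moreover have "f u < max (f r) (f q)" "g u < max (g r) (g q)"
            using pair2[of r q] rq u by auto
          ultimately show "u \<in> R" using True rq(1,2) by (auto simp: ab less_max_iff_disj)
        qed
        ultimately show ?thesis by blast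
      qed (auto simp: X'_def)
      show "card {u \<in> ?V. f u < f x} < k \<and> 2 * m + 1 - k \<le> card ?V" if "x \<in> X' - X" for x
      proof -
        have xp: "x = p" using that by (auto simp: X'_def)
        \<comment> \<open>Points to the left of \<open>p\<close> are in the initial segment
          \<open>P'\<close> and are coloured by the choice of \<open>p\<close>; without
          \<open>d\<close> there are only \<open>k - 1\<close> such points.\<close>
        have "{u \<in> ?V. f u < f p} \<subseteq> P' \<inter> X"
          using low[of p] p by (force simp: not_le[symmetric])
        then have "card {u \<in> ?V. f u < f p} \<le> k - 1"
          using cP'X P'V(3) card_mono by (metis finite_Int)
        then show ?thesis using km late xp by simp
      qed
    qed (use c'X c'k in \<open>auto simp: X'_def\<close>)
    moreover have "sweep_inv f g k m ?V P' X' Z c'" unfolding sweep_inv_def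
    proof (intro conjI ballI impI)
      show "f u < f w" if "u \<in> P'" "w \<in> ?V - P'" for u w by (rule low[OF that])
      show "g u < g q" if q: "q \<in> P' \<inter> X'" "u \<in> P' - X'" "f u < f q" for q u
      proof -
        have "q \<noteq> p" using p(2)[of u] q by (auto simp: X'_def)
        then have "q \<in> P \<inter> X" using q(1) P'X' by auto
        then show ?thesis using left q P' V(3) X(1) by (auto simp: X'_def)
      qed
    qed (use P'V cP' cP'X' inj pair2 late in auto)
    ultimately show ?thesis by blast
  qed
qed

text \<open>The \<open>k\<close> leftmost points are coloured by rank. Choosing them leftmost starts
  the clock below \<open>k\<close> and leaves no uncoloured point to the left of a coloured
  one.\<close>

lemma sweep_start:
  assumes "finite V" "inj_on f V" "card V = m" "0 < k" "k \<le> m"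
    and "v \<in> V" "\<And>u. u \<in> V \<Longrightarrow> g v \<le> g u"
  shows "\<exists>P X Z c. sweep_good f g k m V X Z c \<and> sweep_inv f g k m V P X Z c"
proof -
  obtain X where X: "X \<subseteq> V" "card X = k" and low: "\<And>u w. u \<in> X \<Longrightarrow> w \<in> V - X \<Longrightarrow> f u < f w"
    using obtain_lower_part[OF assms(1,2), of k] assms(3,5) by metis
  have finX: "finite X" using X(1) assms(1) finite_subset by blast
  define c where "c = rank f X"
  have c: "inj_on c X" "c ` X = {..<k}"
    using bij_betw_rank[OF finX inj_on_subset[OF assms(2) X(1)]] X(2) by (auto simp: c_def bij_betw_def)
  have rank_less_k: "card {u \<in> V. h u \<and> f u < f p} < k" if "p \<in> X" for p h
  proof -
    have "{u \<in> V. h u \<and> f u < f p} \<subseteq> X - {p}" using low that by force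
    then have "card {u \<in> V. h u \<and> f u < f p} \<le> card (X - {p})" using finX by (intro card_mono) auto
    then show ?thesis using that X(2) finX assms(4) by simp
  qed
  have "sweep_good f g k m V X X c" unfolding sweep_good_def
  proof (intro conjI ballI allI impI)
    show "{..<k} \<subseteq> c ` ({u \<in> V. f u \<le> a \<and> g w \<le> g u} \<inter> X)"
      if "card {u \<in> V. f u \<le> a \<and> g w \<le> g u} = m" for w a
    proof -
      have "{u \<in> V. f u \<le> a \<and> g w \<le> g u} = V"
        using that assms(1,3) by (intro card_subset_eq) auto
      then show ?thesis using c(2) X(1) by (simp add: Int_absorb1)
    qed
    show "\<exists>Q. late_quadrant f g k m V X Q \<and> Q - X \<subseteq> R"
      if "p \<in> X \<inter> R" "q \<in> X \<inter> R" "p \<noteq> q" "c p = c q" for R p q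
      using that c(1) by (auto dest: inj_onD)
    show "\<exists>w\<in>V. g w \<le> g p \<and> m \<le> card {u \<in> V. g w \<le> g u}
         \<and> card {u \<in> V. g w \<le> g u \<and> f u < f p} < k
         \<and> (p \<in> X \<or> 2 * m + 1 - k \<le> card {u \<in> V. g w \<le> g u})" if p: "p \<in> X" for p
    proof -
      have "{u \<in> V. g v \<le> g u} = V" using assms(7) by auto
      then show ?thesis using assms(3,6,7) p X(1) rank_less_k[OF p] by (intro bexI[of _ v]) auto
    qed
  qed (use X c in auto)
  moreover have "sweep_inv f g k m V V X X c" unfolding sweep_inv_def
  proof (intro conjI ballI impI)
    have "V \<inter> X = X" using X(1) by blast
    then show "card (V \<inter> X) = k" "inj_on c (V \<inter> X)" using X(2) c(1) by auto
    show "X = X \<and> (\<forall>q\<in>X. card {u \<in> V. f u < f q} < k + (card V - m)) \<or> 2 * m + 1 - k \<le> card V"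
      using rank_less_k[of _ "\<lambda>_. True"] by (auto intro: trans_less_add1)
    show "g u < g q" if "q \<in> V \<inter> X" "u \<in> V - X" "f u < f q" for q u
      using low[of q u] that by auto
  qed (use assms(3) c(1) in \<open>auto dest: inj_onD\<close>)
  ultimately show ?thesis by blast
qed

lemma sweep_colouring:
  assumes "finite V" "inj_on f V" "inj_on g V" "0 < k" "k \<le> m"
  shows "\<exists>X Z c. sweep_good f g k m V X Z c"
proof -
  have "card V < m \<or> (\<exists>P X Z c. sweep_good f g k m V X Z c \<and> sweep_inv f g k m V P X Z c)"
    using assms(1-3)
  proof (induction V rule: finite_ranking_induct[where f = "\<lambda>v. - g v"])
    case (insert v V)
    show ?case
    proof (cases "v \<in> V")
      case True
      then show ?thesis using insert by (simp add: insert_absorb)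
    next
      case False
      have low: "g v < g u" if "u \<in> V" for u
        using insert.hyps(2)[OF that] inj_onD[OF insert.prems(2), of v u] that False
        by (cases "g v = g u") auto
      have injV: "inj_on f V" "inj_on g V" using insert.prems by (auto intro: inj_on_subset)
      consider "card V < m" "card (insert v V) < m" | "card (insert v V) = m"
        | P X Z c where "sweep_good f g k m V X Z c" "sweep_inv f g k m V P X Z c"
        using insert.IH[OF injV] insert.hyps(1) False by fastforce
      then show ?thesis
      proof cases
        case 2
        have "g v \<le> g u" if "u \<in> insert v V" for u using low that by (auto simp: less_imp_le)
        then show ?thesis
          using sweep_start[of "insert v V" f m k v g] insert.hyps(1) insert.prems(1) 2 assms(4,5) by auto
      next
        case 3
        then show ?thesis
          using sweep_step[of V v g f k m, OF insert.hyps(1) False low insert.prems(1) assms(4,5)] by blast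
      qed simp
    qed
  qed (use assms in auto)
  \<comment> \<open>With fewer than \<open>m\<close> points no quadrant is large enough, and
    colouring nothing is correct.\<close>
  moreover have "sweep_good f g k m V {} {} c" if "card V < m" for c
  proof -
    have "card {u \<in> V. f u \<le> a \<and> g w \<le> g u} \<noteq> m" for a w
      using that card_mono[OF assms(1), of "{u \<in> V. f u \<le> a \<and> g w \<le> g u}"] by auto
    then show ?thesis by (simp add: sweep_good_def)
  qed
  ultimately show ?thesis by blast
qed

section \<open>Interaction of two opposite sweeps\<close>

lemma card_split_at:
  fixes f :: "'a \<Rightarrow> real"
  assumes "finite W" "inj_on f W" "p \<in> W"
  shows "card W = card {u \<in> W. f u < f p} + card {u \<in> W. f p < f u} + 1"
proof -
  have "W = insert p ({u \<in> W. f u < f p} \<union> {u \<in> W. f p < f u})"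
    using assms(2,3) by (auto dest: inj_onD) (metis inj_onD linorder_neqE)
  also have "card \<dots> = Suc (card ({u \<in> W. f u < f p} \<union> {u \<in> W. f p < f u}))"
    using assms(1) by (subst card_insert_disjoint) auto
  also have "card ({u \<in> W. f u < f p} \<union> {u \<in> W. f p < f u})
      = card {u \<in> W. f u < f p} + card {u \<in> W. f p < f u}"
    using assms(1) by (intro card_Un_disjoint) auto
  finally show ?thesis by simp
qed

lemma sweep_goodD:
  assumes "sweep_good f g k m V X Z c"
  shows "X \<subseteq> V" "c ` X \<subseteq> {..<k}" "Z \<subseteq> X" "card Z \<le> k"
    and "\<And>w a. w \<in> V \<Longrightarrow> card {u \<in> V. f u \<le> a \<and> g w \<le> g u} = m
      \<Longrightarrow> {..<k} \<subseteq> c ` ({u \<in> V. f u \<le> a \<and> g w \<le> g u} \<inter> X)"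
    and "\<And>R p q. R \<in> bottomless f g \<Longrightarrow> p \<in> X \<inter> R \<Longrightarrow> q \<in> X \<inter> R \<Longrightarrow> p \<noteq> q \<Longrightarrow> c p = c q
      \<Longrightarrow> \<exists>Q. late_quadrant f g k m V X Q \<and> Q - X \<subseteq> R"
    and "\<And>p. p \<in> X \<Longrightarrow> \<exists>w\<in>V. g w \<le> g p \<and> m \<le> card {u \<in> V. g w \<le> g u}
      \<and> card {u \<in> V. g w \<le> g u \<and> f u < f p} < k
      \<and> (p \<in> Z \<or> 2 * m + 1 - k \<le> card {u \<in> V. g w \<le> g u})"
  using assms unfolding sweep_good_def by - (elim conjE, simp)+

text \<open>At the earlier of the two recorded moments, that is at the higher level, a common point
  would have fewer than \<open>k\<close> points on either side. That leaves at most
  \<open>2 * k - 1\<close> points, although \<open>m\<close> have arrived.\<close>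

lemma opposite_sweeps_disjoint:
  assumes V: "finite V" "inj_on f V" and m: "2 * k \<le> m"
    and X: "sweep_good f g k m V X Z c" and Y: "sweep_good (\<lambda>v. - f v) g k m V Y W d"
  shows "X \<inter> Y = {}"
proof (rule ccontr)
  assume "X \<inter> Y \<noteq> {}"
  then obtain p where p: "p \<in> X" "p \<in> Y" by blast
  obtain w where w: "g w \<le> g p" "m \<le> card {u \<in> V. g w \<le> g u}"
    "card {u \<in> V. g w \<le> g u \<and> f u < f p} < k"
    using sweep_goodD(7)[OF X p(1)] by blast
  obtain x where x: "g x \<le> g p" "m \<le> card {u \<in> V. g x \<le> g u}"
    "card {u \<in> V. g x \<le> g u \<and> f p < f u} < k"
    using sweep_goodD(7)[OF Y p(2)] by auto
  define b where "b = max (g w) (g x)"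
  define U where "U = {u \<in> V. b \<le> g u}"
  have U: "finite U" "inj_on f U" "p \<in> U" "m \<le> card U"
    using V w(1,2) x(1,2) p(1) sweep_goodD(1)[OF X]
    by (auto simp: U_def b_def max_def intro: inj_on_subset)
  have "card {u \<in> U. f u < f p} \<le> card {u \<in> V. g w \<le> g u \<and> f u < f p}"
    using V(1) by (intro card_mono) (auto simp: U_def b_def)
  moreover have "card {u \<in> U. f p < f u} \<le> card {u \<in> V. g x \<le> g u \<and> f p < f u}"
    using V(1) by (intro card_mono) (auto simp: U_def b_def)
  ultimately show False using card_split_at[OF U(1-3)] U(4) w(3) x(3) m by linarith
qed

text \<open>Only start points of the opposite sweep can lie in \<open>Q\<close>. For any other, the
  points at the earlier moment are at most m - 1 in \<open>Q\<close> to its left, at most k - 1 to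
  its right and the point itself, together m + k - 1, which is less than the 2m + 1 - k
  present.\<close>

lemma late_quadrant_opposite_sweep:
  assumes V: "finite V" "inj_on f V" and m: "2 * k \<le> m" "0 < k"
    and Q: "late_quadrant f g k m V X Q" and Y: "sweep_good (\<lambda>v. - f v) g k m V Y W d"
  shows "card (Q \<inter> Y) \<le> k"
proof -
  obtain w a where wa: "w \<in> V" "Q = {u \<in> V. f u \<le> a \<and> g w \<le> g u}" "card Q = m"
    "2 * m + 1 - k \<le> card {u \<in> V. g w \<le> g u}"
    using Q unfolding late_quadrant_def by blast
  have "Q \<inter> Y \<subseteq> W"
  proof
    fix p assume p: "p \<in> Q \<inter> Y"
    obtain x where x: "g x \<le> g p" "card {u \<in> V. g x \<le> g u \<and> f p < f u} < k"
      "p \<in> W \<or> 2 * m + 1 - k \<le> card {u \<in> V. g x \<le> g u}"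
      using sweep_goodD(7)[OF Y, of p] p by auto
    show "p \<in> W"
    proof (rule ccontr)
      assume "p \<notin> W"
      define b where "b = max (g w) (g x)"
      define U where "U = {u \<in> V. b \<le> g u}"
      have U: "finite U" "inj_on f U" "p \<in> U" "2 * m + 1 - k \<le> card U"
        using V wa x p \<open>p \<notin> W\<close> by (auto simp: U_def b_def max_def intro: inj_on_subset)
      have "card {u \<in> U. f u < f p} \<le> card (Q - {p})"
        using V(1) p wa(2) by (intro card_mono) (auto simp: U_def b_def)
      then have "card {u \<in> U. f u < f p} \<le> m - 1" using p wa(3) by simp
      moreover have "card {u \<in> U. f p < f u} \<le> card {u \<in> V. g x \<le> g u \<and> f p < f u}"
        using V(1) by (intro card_mono) (auto simp: U_def b_def)
      ultimately show False using card_split_at[OF U(1-3)] U(4) x(2) m by linarith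
    qed
  qed
  moreover have "finite W" using sweep_goodD(1,3)[OF Y] V(1) by (meson finite_subset)
  ultimately show ?thesis using sweep_goodD(4)[OF Y] card_mono by (meson order.trans)
qed

lemma bottomless_minus: "bottomless (\<lambda>v. - f v) g = bottomless f g"
proof -
  have "bottomless (\<lambda>v. - f v) g \<subseteq> bottomless f g" for f
  proof
    fix R assume "R \<in> bottomless (\<lambda>v. - f v) g"
    then obtain a1 a2 b where "R = {v. a1 \<le> - f v \<and> - f v \<le> a2 \<and> g v \<le> b}" by (auto simp: bottomless_def)
    then have "R = {v. - a2 \<le> f v \<and> f v \<le> - a1 \<and> g v \<le> b}" by auto
    then show "R \<in> bottomless f g" by (auto simp: bottomless_def)
  qed
  from this[of f] this[of "\<lambda>v. - f v"] show ?thesis by auto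
qed

text \<open>Raising the lower side of the quadrant to its lowest point of \<open>V\<close> turns it
  into one at a level of the sweep.\<close>

lemma sweep_good_quadrant:
  assumes "finite V" "0 < m" "sweep_good f g k m V X Z c" "Q \<in> quadrants f g" "card (V \<inter> Q) = m"
  shows "{..<k} \<subseteq> c ` (X \<inter> Q)"
proof -
  obtain a b where ab: "Q = {v. f v \<le> a \<and> b \<le> g v}" using assms(4) by (auto simp: quadrants_def)
  have "V \<inter> Q \<noteq> {}" using assms(2,5) by auto
  then obtain w where w: "w \<in> V \<inter> Q" "\<And>u. u \<in> V \<inter> Q \<Longrightarrow> g w \<le> g u"
    using assms(1) by (metis arg_min_if_finite(1) arg_min_least finite_Int)
  have eq: "V \<inter> Q = {u \<in> V. f u \<le> a \<and> g w \<le> g u}" using w by (auto simp: ab intro: order.trans)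
  have "{..<k} \<subseteq> c ` ((V \<inter> Q) \<inter> X)"
    using sweep_goodD(5)[OF assms(3), of w a] w(1) assms(5) unfolding eq by blast
  then show ?thesis by blast
qed

text \<open>The threshold is k + k + (3k - 2): each sweep costs a rectangle at most \<open>k\<close>
  points, and the rest is what bottomless rectangles need on their own.\<close>

lemma bottomless_two_quadrants:
  assumes V: "finite V" "inj_on f V" "inj_on g V" and k: "0 < k" and m: "m = 5 * k - 2"
  shows "\<exists>c. \<forall>R\<in>bottomless f g \<union> quadrants f g \<union> quadrants (\<lambda>v. - f v) g.
    card (V \<inter> R) = m \<longrightarrow> {..<k} \<subseteq> c ` (V \<inter> R)"
proof -
  have km: "2 * k \<le> m" "k \<le> m" "0 < m" using k m by auto
  have inj': "inj_on (\<lambda>v. - f v) V" using V(2) by (auto simp: inj_on_def)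
  obtain X Z c where X: "sweep_good f g k m V X Z c"
    using sweep_colouring[OF V k km(2)] by blast
  obtain Y W d where Y: "sweep_good (\<lambda>v. - f v) g k m V Y W d"
    using sweep_colouring[OF V(1) inj' V(3) k km(2)] by blast
  have XY: "X \<inter> Y = {}" by (rule opposite_sweeps_disjoint[OF V(1,2) km(1) X Y])
  define U where "U = V - X - Y"
  have large: "3 * k - 2 \<le> card (U \<inter> R)" if R: "R \<in> bottomless f g" "card (V \<inter> R) = m" for R
  proof -
    \<comment> \<open>\<open>A\<close> stands for the sweep that repeats a colour in
      \<open>R\<close> and \<open>B\<close> for the other one. \<open>R\<close> then inherits the m
      - 2k points of \<open>Q\<close> that neither has coloured.\<close>
    have quad: "3 * k - 2 \<le> card (U \<inter> R)"
      if "card Q = m" "card (Q \<inter> A) = k" "card (Q \<inter> B) \<le> k" "Q - A \<subseteq> R" "Q \<subseteq> V" "A \<union> B = X \<union> Y" for Q A B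
    proof -
      have fQ: "finite Q" using that(5) V(1) finite_subset by blast
      have "card (Q - A) = m - k" using that(1,2) fQ by (simp add: card_Diff_subset_Int)
      moreover have "card (Q - A) - card (Q \<inter> B) \<le> card (Q - A - Q \<inter> B)"
        using fQ by (intro diff_card_le_card_Diff) auto
      moreover have "card (Q - A - Q \<inter> B) \<le> card (U \<inter> R)"
        using that(4-6) V(1) by (intro card_mono) (auto simp: U_def)
      ultimately show ?thesis using that(3) m by linarith
    qed
    consider "inj_on c (X \<inter> R)" "inj_on d (Y \<inter> R)"
      | p q where "p \<in> X \<inter> R" "q \<in> X \<inter> R" "p \<noteq> q" "c p = c q"
      | p q where "p \<in> Y \<inter> R" "q \<in> Y \<inter> R" "p \<noteq> q" "d p = d q"
      by (auto simp: inj_on_def)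
    then show ?thesis
    proof cases
      case 1
      have "card (X \<inter> R) \<le> k" "card (Y \<inter> R) \<le> k"
        using card_inj_on_le[OF 1(1), of "{..<k}"] card_inj_on_le[OF 1(2), of "{..<k}"]
          sweep_goodD(2)[OF X] sweep_goodD(2)[OF Y] by auto
      then have "card (X \<inter> R \<union> Y \<inter> R) \<le> 2 * k" using card_Un_le[of "X \<inter> R" "Y \<inter> R"] by linarith
      moreover have "finite (X \<inter> R \<union> Y \<inter> R)"
        using V(1) sweep_goodD(1)[OF X] sweep_goodD(1)[OF Y] by (meson finite_Int finite_UnI finite_subset)
      then have "card (V \<inter> R) - card (X \<inter> R \<union> Y \<inter> R) \<le> card (V \<inter> R - (X \<inter> R \<union> Y \<inter> R))"
        by (rule diff_card_le_card_Diff)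
      moreover have "V \<inter> R - (X \<inter> R \<union> Y \<inter> R) = U \<inter> R" by (auto simp: U_def)
      ultimately show ?thesis using R(2) m by simp
    next
      case 2
      then obtain Q where Q: "late_quadrant f g k m V X Q" "Q - X \<subseteq> R"
        using sweep_goodD(6)[OF X R(1)] by blast
      then show ?thesis
        using late_quadrant_opposite_sweep[OF V(1,2) km(1) k Q(1) Y]
        by (intro quad[of Q X Y]) (auto simp: late_quadrant_def)
    next
      case 3
      have "R \<in> bottomless (\<lambda>v. - f v) g" using R(1) by (simp add: bottomless_minus)
      from sweep_goodD(6)[OF Y this 3] obtain Q
        where Q: "late_quadrant (\<lambda>v. - f v) g k m V Y Q" "Q - Y \<subseteq> R" by blast
      then show ?thesis
        using late_quadrant_opposite_sweep[OF V(1) inj' km(1) k Q(1), of X Z c] X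
        by (intro quad[of Q Y X]) (auto simp: late_quadrant_def)
    qed
  qed
  have "colourable k U (bottomless f g) (3 * k - 2)"
    using V k by (intro colourable_bottomless) (auto simp: U_def intro: inj_on_subset)
  then obtain e where e: "\<forall>R\<in>bottomless f g. 3 * k - 2 \<le> card (U \<inter> R) \<longrightarrow> {..<k} \<subseteq> e ` (U \<inter> R)"
    unfolding colourable_def by (elim exE)
  define h where "h v = (if v \<in> X then c v else if v \<in> Y then d v else e v)" for v
  have "{..<k} \<subseteq> h ` (V \<inter> R)" if R: "R \<in> bottomless f g \<union> quadrants f g \<union> quadrants (\<lambda>v. - f v) g"
    "card (V \<inter> R) = m" for R
  proof -
    consider "R \<in> bottomless f g" | "R \<in> quadrants f g" | "R \<in> quadrants (\<lambda>v. - f v) g"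
      using R(1) by blast
    then show ?thesis
    proof cases
      case 1
      then have "{..<k} \<subseteq> e ` (U \<inter> R)" using e large R(2) by simp
      also have "e ` (U \<inter> R) = h ` (U \<inter> R)" by (intro image_cong) (auto simp: h_def U_def)
      also have "\<dots> \<subseteq> h ` (V \<inter> R)" by (auto simp: U_def)
      finally show ?thesis .
    next
      case 2
      have "{..<k} \<subseteq> c ` (X \<inter> R)" by (rule sweep_good_quadrant[OF V(1) km(3) X 2 R(2)])
      also have "c ` (X \<inter> R) = h ` (X \<inter> R)" by (intro image_cong) (auto simp: h_def)
      also have "\<dots> \<subseteq> h ` (V \<inter> R)" using sweep_goodD(1)[OF X] by blast
      finally show ?thesis .
    next
      case 3
      have "{..<k} \<subseteq> d ` (Y \<inter> R)" by (rule sweep_good_quadrant[OF V(1) km(3) Y 3 R(2)])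
      also have "d ` (Y \<inter> R) = h ` (Y \<inter> R)" using XY by (intro image_cong) (auto simp: h_def)
      also have "\<dots> \<subseteq> h ` (V \<inter> R)" using sweep_goodD(1)[OF Y] by blast
      finally show ?thesis .
    qed
  qed
  then show ?thesis by blast
qed


section \<open>The range families\<close>

lemma colourable_mono: "colourable k V \<R> m \<Longrightarrow> m \<le> n \<Longrightarrow> colourable k V \<R> n"
  unfolding colourable_def by (meson order.trans)

text \<open>At 1 the quadratic bound for \<open>exp\<close> gives only 3; at 1/16 its sixteenth
  power is about 2.797.\<close>

lemma exp_1_less: "exp 1 < (14 / 5 :: real)"
proof -
  have "exp (1 / 16) \<le> 1 + 1 / 16 + (1 / 16 :: real)\<^sup>2" by (rule exp_bound) auto
  then have "exp (1 / 16) ^ 16 \<le> (273 / 256 :: real) ^ 16"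
    by (intro power_mono) (auto simp: power2_eq_square)
  also have "\<dots> < 14 / 5" by (simp add: power_divide)
  also have "exp (1 / 16) ^ 16 = exp (1 :: real)" by (simp flip: exp_of_nat_mult)
  finally show ?thesis .
qed

lemma strip_threshold:
  fixes k :: nat
  defines "x \<equiv> 4 * real k * ln (real k) + real k * ln 3"
  shows "k = 1 \<Longrightarrow> 1 \<le> nat \<lceil>x\<rceil>" "k = 2 \<Longrightarrow> 7 \<le> nat \<lceil>x\<rceil>" "3 \<le> k \<Longrightarrow> 6 * k - 1 \<le> nat \<lceil>x\<rceil>"
proof -
  have ln3: "1 \<le> ln (3 :: real)" using exp_le by (simp add: ln_ge_iff)
  have "exp 1 ^ 2 \<le> (14 / 5 :: real) ^ 2" using exp_1_less by (intro power_mono) auto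
  also have "\<dots> \<le> 2 ^ 3" by (simp add: power2_eq_square)
  finally have "exp 2 \<le> (2 :: real) ^ 3" by (simp flip: exp_of_nat_mult)
  then have "2 \<le> ln ((2 :: real) ^ 3)" by (simp add: ln_ge_iff)
  then have ln2: "2 / 3 \<le> ln (2 :: real)" using ln_realpow[of 2 3] by simp
  show "1 \<le> nat \<lceil>x\<rceil>" if "k = 1" using ln3 by (simp add: x_def that le_nat_iff le_ceiling_iff)
  show "7 \<le> nat \<lceil>x\<rceil>" if "k = 2"
  proof -
    have "6 < x" using ln2 ln3 by (simp add: x_def that)
    then show ?thesis by (simp add: le_nat_iff le_ceiling_iff)
  qed
  show "6 * k - 1 \<le> nat \<lceil>x\<rceil>" if k: "3 \<le> k"
  proof (cases "k = 3")
    case True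
    \<comment> \<open>For k = 3 the claim amounts to 16 < 15 ln 3, that is e^16 < 3^15. The constant
      14/5 is barely small enough for it.\<close>
    have "exp 1 ^ 16 \<le> (14 / 5 :: real) ^ 16" using exp_1_less by (intro power_mono) auto
    also have "\<dots> < 3 ^ 15" by (simp add: power_divide)
    finally have "exp 16 < (3 :: real) ^ 15" by (simp flip: exp_of_nat_mult)
    then have "ln (exp 16) < ln ((3 :: real) ^ 15)" by (subst ln_less_cancel_iff) auto
    then have "16 < ln ((3 :: real) ^ 15)" by simp
    then have "16 < x" using ln_realpow[of 3 15] by (simp add: x_def True)
    then show ?thesis by (simp add: True le_nat_iff le_ceiling_iff)
  next
    case False
    then have "ln 4 \<le> ln (real k)" using k by simp
    moreover have "ln 4 = 2 * ln (2 :: real)" using ln_realpow[of 2 2] by simp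
    ultimately have "5 \<le> 4 * ln (real k)" using ln2 by linarith
    then have "6 \<le> 4 * ln (real k) + ln 3" using ln3 by linarith
    then have "real k * 6 \<le> real k * (4 * ln (real k) + ln 3)" by (intro mult_left_mono) auto
    then have "6 * real k \<le> x" by (simp add: x_def algebra_simps)
    then have "6 * int k \<le> \<lceil>x\<rceil>" by (simp add: le_ceiling_iff)
    then show ?thesis by simp
  qed
qed

text \<open>One colour needs only nonempty ranges, two colours need the sign argument, and from
  three colours on the Hall bound \<open>6 * k - 1\<close> stays within the logarithmic one.\<close>

lemma colourable_three_strips:
  assumes "finite V" "finite F" "F \<noteq> {}" "card F \<le> 3" "\<And>f. f \<in> F \<Longrightarrow> inj_on f V" "1 \<le> k"
  shows "colourable k V (\<Union>(strips ` F)) (nat \<lceil>4 * real k * ln (real k) + real k * ln 3\<rceil>)"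
proof -
  consider "k = 1" | "k = 2" | "3 \<le> k" using assms(6) by linarith
  then show ?thesis
  proof cases
    case 1
    have "colourable k V (\<Union>(strips ` F)) 1"
      unfolding colourable_def 1 by (intro exI[of _ "\<lambda>_. 0"]) (auto simp: card_gt_0_iff Suc_le_eq)
    then show ?thesis using strip_threshold(1)[OF 1] by (rule colourable_mono)
  next
    case 2
    have "colourable k V (\<Union>(strips ` F)) 7"
      unfolding 2 by (rule two_colourable_three_strips) (use assms in auto)
    then show ?thesis using strip_threshold(2)[OF 2] by (rule colourable_mono)
  next
    case 3
    have "colourable k V (\<Union>(strips ` F)) (2 * (card F * k) - 1)"
      by (rule colourable_strips) (use assms in auto)
    moreover have "card F * k \<le> 3 * k" using assms(4) by simp
    then have "2 * (card F * k) - 1 \<le> 6 * k - 1" by linarith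
    then have "2 * (card F * k) - 1 \<le> nat \<lceil>4 * real k * ln (real k) + real k * ln 3\<rceil>"
      using strip_threshold(3)[OF 3] by (rule order.trans)
    ultimately show ?thesis by (rule colourable_mono)
  qed
qed

lemma m_R_le:
  assumes "0 < k" and "\<And>V. finite V \<Longrightarrow> general_position V
    \<Longrightarrow> \<exists>c. \<forall>R\<in>\<R>. card (V \<inter> R) = m \<longrightarrow> {..<k} \<subseteq> c ` (V \<inter> R)"
  shows "m_R \<R> k \<le> enat m"
proof -
  have "\<exists>c. (\<forall>x\<in>V. c x < k) \<and> polychromatic k c (hyperedges V \<R> m)"
    if V: "finite V" "general_position V" for V
  proof -
    obtain c where c: "\<forall>R\<in>\<R>. card (V \<inter> R) = m \<longrightarrow> {..<k} \<subseteq> c ` (V \<inter> R)"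
      using assms(2)[OF V] by (elim exE)
    \<comment> \<open>Colours outside \<open>{..<k}\<close> are sent to 0, a legal colour since
      \<open>k > 0\<close>; no colour class below \<open>k\<close> loses a point.\<close>
    define d where "d v = (if c v < k then c v else 0)" for v
    have "\<exists>x\<in>e. d x = i" if "e \<in> hyperedges V \<R> m" "i < k" for e i
    proof -
      have "i \<in> c ` e" using c that by (auto simp: hyperedges_def)
      then show ?thesis using that(2) by (auto simp: d_def)
    qed
    then show ?thesis using assms(1) by (intro exI[of _ d]) (auto simp: polychromatic_def d_def)
  qed
  then have "admits_poly \<R> k m" by (simp add: admits_poly_def)
  then show ?thesis unfolding m_R_def by (intro Inf_lower) blast
qed

lemma general_position_subset: "general_position V \<Longrightarrow> U \<subseteq> V \<Longrightarrow> general_position U"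
  unfolding general_position_def by (meson inj_on_subset)

text \<open>The factors \<open>s\<close> and \<open>t\<close> reflect the axes, so that one
  statement serves all four quadrant types; general position passes to subsets and survives the
  reflections as injectivity.\<close>

lemma colourable_add_quadrants_general_position:
  assumes "\<And>V. finite V \<Longrightarrow> general_position V \<Longrightarrow> colourable k V \<R> m"
    and "\<And>R. R \<in> \<R> \<Longrightarrow> chain_convex (\<lambda>p. s * fst p) (\<lambda>p. t * snd p) R"
    and "s \<noteq> 0" "t \<noteq> 0" "finite V" "general_position V"
  shows "colourable k V (\<R> \<union> quadrants (\<lambda>p. s * fst p) (\<lambda>p. t * snd p)) (m + 2 * k)"
proof (rule colourable_add_quadrants)
  show "colourable k U \<R> m" if "U \<subseteq> V" for U
    using assms(1,5,6) that finite_subset general_position_subset by metis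
qed (use assms in \<open>auto simp: general_position_def inj_on_def\<close>)

lemma quadrantsI: "R = {v. f v \<le> a \<and> b \<le> g v} \<Longrightarrow> R \<in> quadrants f g"
  by (auto simp: quadrants_def)

lemma range_families_quadrants:
  "R_NW \<subseteq> quadrants (\<lambda>p. 1 * fst p) (\<lambda>p. 1 * snd p)" "R_NE \<subseteq> quadrants (\<lambda>p. -1 * fst p) (\<lambda>p. 1 * snd p)"
  "R_SW \<subseteq> quadrants (\<lambda>p. 1 * fst p) (\<lambda>p. -1 * snd p)" "R_SE \<subseteq> quadrants (\<lambda>p. -1 * fst p) (\<lambda>p. -1 * snd p)"
proof -
  show "R_NW \<subseteq> quadrants (\<lambda>p. 1 * fst p) (\<lambda>p. 1 * snd p)" by (auto simp: R_NW_def quadrants_def)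
  have "{p. fst p \<ge> a \<and> snd p \<ge> b} \<in> quadrants (\<lambda>p. -1 * fst p) (\<lambda>p. 1 * snd p)" for a b :: real
    by (rule quadrantsI[of _ _ "- a" b]) auto
  then show "R_NE \<subseteq> quadrants (\<lambda>p. -1 * fst p) (\<lambda>p. 1 * snd p)" by (auto simp: R_NE_def)
  have "{p. fst p \<le> a \<and> snd p \<le> b} \<in> quadrants (\<lambda>p. 1 * fst p) (\<lambda>p. -1 * snd p)" for a b :: real
    by (rule quadrantsI[of _ _ a "- b"]) auto
  then show "R_SW \<subseteq> quadrants (\<lambda>p. 1 * fst p) (\<lambda>p. -1 * snd p)" by (auto simp: R_SW_def)
  have "{p. fst p \<ge> a \<and> snd p \<le> b} \<in> quadrants (\<lambda>p. -1 * fst p) (\<lambda>p. -1 * snd p)" for a b :: real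
    by (rule quadrantsI[of _ _ "- a" "- b"]) auto
  then show "R_SE \<subseteq> quadrants (\<lambda>p. -1 * fst p) (\<lambda>p. -1 * snd p)" by (auto simp: R_SE_def)
qed

lemma range_families_strips:
  "R_HS = strips snd" "R_VS = strips fst" "R_DS = strips (\<lambda>p. fst p + snd p)" "R_BL = bottomless fst snd"
  by (simp_all add: R_HS_def R_VS_def R_DS_def R_BL_def strips_def bottomless_def)

text \<open>Reflections preserve betweenness, and every axis-parallel range contains the points that
  lie between two of its points in both coordinates.\<close>

lemma chain_convex_axis_families:
  assumes "s \<in> {1, -1}" "t \<in> {1, -1}"
    and "R \<in> strips snd \<union> strips fst \<or> (\<exists>s'\<in>{1, -1}. \<exists>t'\<in>{1, -1}. R \<in> quadrants (\<lambda>p. s' * fst p) (\<lambda>p. t' * snd p))"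
  shows "chain_convex (\<lambda>p. s * fst p) (\<lambda>p. t * snd p) R"
  unfolding chain_convex_def
proof (intro ballI allI impI)
  fix p r z
  assume pr: "p \<in> R" "r \<in> R"
    and "s * fst p < s * fst z \<and> s * fst z < s * fst r \<and> t * snd p < t * snd z \<and> t * snd z < t * snd r"
  then have "min (fst p) (fst r) \<le> fst z" "fst z \<le> max (fst p) (fst r)"
    "min (snd p) (snd r) \<le> snd z" "snd z \<le> max (snd p) (snd r)"
    using assms(1,2) by auto
  then show "z \<in> R" using pr assms(3) by (auto simp: strips_def quadrants_def min_def max_def split: if_splits)
qed

text \<open>The same sign on both axes is essential: then x + y is monotone along chains. With
  opposite signs a point between two others can leave a diagonal strip.\<close>

lemma chain_convex_diagonal_families:
  assumes "s \<in> {1, -1}"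
    and "R \<in> strips snd \<union> strips fst \<union> strips (\<lambda>p. fst p + snd p)
      \<or> (\<exists>s'\<in>{1, -1}. \<exists>t'\<in>{1, -1}. R \<in> quadrants (\<lambda>p. s' * fst p) (\<lambda>p. t' * snd p))"
  shows "chain_convex (\<lambda>p. s * fst p) (\<lambda>p. s * snd p) R"
proof (cases "R \<in> strips (\<lambda>p. fst p + snd p)")
  case True
  then show ?thesis using assms(1) by (auto simp: chain_convex_def strips_def)
next
  case False
  then show ?thesis using assms by (intro chain_convex_axis_families) auto
qed

theorem theorem17:
  fixes k :: nat
  assumes "k \<ge> 1"
  shows "m_R (R_BL \<union> R_NW \<union> R_NE) k \<le> enat (5 * k - 2)
    \<and> m_R (R_HS \<union> R_VS \<union> R_NW \<union> R_NE \<union> R_SW \<union> R_SE) k \<le> enat (10 * k - 1)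
    \<and> m_R (R_HS \<union> R_VS \<union> R_DS \<union> R_NW \<union> R_SE) k
           \<le> enat (nat \<lceil>4 * real k * ln (real k) + real k * ln 3\<rceil> + 4 * k)"
proof (intro conjI)
  have k: "0 < k" using assms by simp
  let ?q = "\<lambda>s t. quadrants (\<lambda>p. s * fst p) (\<lambda>p. t * snd p)"
  show "m_R (R_BL \<union> R_NW \<union> R_NE) k \<le> enat (5 * k - 2)"
  proof (rule m_R_le[OF k])
    fix V assume V: "finite V" "general_position V"
    have "\<exists>c. \<forall>R\<in>bottomless fst snd \<union> quadrants fst snd \<union> quadrants (\<lambda>v. - fst v) snd.
      card (V \<inter> R) = 5 * k - 2 \<longrightarrow> {..<k} \<subseteq> c ` (V \<inter> R)"
      by (rule bottomless_two_quadrants) (use V k in \<open>auto simp: general_position_def\<close>)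
    then show "\<exists>c. \<forall>R\<in>R_BL \<union> R_NW \<union> R_NE. card (V \<inter> R) = 5 * k - 2 \<longrightarrow> {..<k} \<subseteq> c ` (V \<inter> R)"
      using range_families_quadrants(1,2) range_families_strips(4) by simp blast
  qed
  show "m_R (R_HS \<union> R_VS \<union> R_NW \<union> R_NE \<union> R_SW \<union> R_SE) k \<le> enat (10 * k - 1)"
  proof (rule m_R_le[OF k])
    fix V assume V: "finite V" "general_position V"
    have c0: "colourable k U (strips snd \<union> strips fst) (2 * k - 1)"
      if "finite U" "general_position U" for U
      by (rule colourable_two_strips) (use that k in \<open>auto simp: general_position_def\<close>)
    note step = colourable_add_quadrants_general_position
    have c1: "colourable k U (strips snd \<union> strips fst \<union> ?q 1 1) (2 * k - 1 + 2 * k)"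
      if "finite U" "general_position U" for U
      by (rule step, erule (1) c0, rule chain_convex_axis_families) (use that in auto)
    have c2: "colourable k U (strips snd \<union> strips fst \<union> ?q 1 1 \<union> ?q (-1) 1) (2 * k - 1 + 2 * k + 2 * k)"
      if "finite U" "general_position U" for U
      by (rule step, erule (1) c1, rule chain_convex_axis_families) (use that in auto)
    have c3: "colourable k U (strips snd \<union> strips fst \<union> ?q 1 1 \<union> ?q (-1) 1 \<union> ?q 1 (-1))
        (2 * k - 1 + 2 * k + 2 * k + 2 * k)"
      if "finite U" "general_position U" for U
      by (rule step, erule (1) c2, rule chain_convex_axis_families) (use that in auto)
    have "colourable k V (strips snd \<union> strips fst \<union> ?q 1 1 \<union> ?q (-1) 1 \<union> ?q 1 (-1) \<union> ?q (-1) (-1))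
        (2 * k - 1 + 2 * k + 2 * k + 2 * k + 2 * k)"
      by (rule step, erule (1) c3, rule chain_convex_axis_families) (use V in auto)
    \<comment> \<open>Four quadrant types at 2k points each, on top of 2k - 1 for the two strip
      directions.\<close>
    moreover have "2 * k - 1 + 2 * k + 2 * k + 2 * k + 2 * k = 10 * k - 1" using k by linarith
    ultimately obtain c where c: "\<forall>R\<in>strips snd \<union> strips fst \<union> ?q 1 1 \<union> ?q (-1) 1 \<union> ?q 1 (-1) \<union> ?q (-1) (-1).
        10 * k - 1 \<le> card (V \<inter> R) \<longrightarrow> {..<k} \<subseteq> c ` (V \<inter> R)"
      unfolding colourable_def by auto
    have "R_HS \<union> R_VS \<union> R_NW \<union> R_NE \<union> R_SW \<union> R_SE
        \<subseteq> strips snd \<union> strips fst \<union> ?q 1 1 \<union> ?q (-1) 1 \<union> ?q 1 (-1) \<union> ?q (-1) (-1)"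
      using range_families_quadrants unfolding range_families_strips by blast
    note sub = subsetD[OF this]
    show "\<exists>c. \<forall>R\<in>R_HS \<union> R_VS \<union> R_NW \<union> R_NE \<union> R_SW \<union> R_SE.
        card (V \<inter> R) = 10 * k - 1 \<longrightarrow> {..<k} \<subseteq> c ` (V \<inter> R)"
    proof (intro exI[of _ c] ballI impI, goal_cases)
      case (1 R)
      then show ?case using bspec[OF c sub[OF 1(1)]] by simp
    qed
  qed
  let ?M = "nat \<lceil>4 * real k * ln (real k) + real k * ln 3\<rceil>"
  show "m_R (R_HS \<union> R_VS \<union> R_DS \<union> R_NW \<union> R_SE) k \<le> enat (?M + 4 * k)"
  proof (rule m_R_le[OF k])
    fix V assume V: "finite V" "general_position V"
    let ?d = "\<lambda>p :: point. fst p + snd p"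
    have c0: "colourable k U (strips snd \<union> strips fst \<union> strips ?d) ?M"
      if "finite U" "general_position U" for U
    proof -
      have "card {snd, fst, ?d} \<le> 3" by (simp add: card_insert_if)
      then have "colourable k U (\<Union>(strips ` {snd, fst, ?d})) ?M"
        by (intro colourable_three_strips) (use that assms in \<open>auto simp: general_position_def\<close>)
      then show ?thesis by (simp add: Un_assoc)
    qed
    note step = colourable_add_quadrants_general_position
    have c1: "colourable k U (strips snd \<union> strips fst \<union> strips ?d \<union> ?q 1 1) (?M + 2 * k)"
      if "finite U" "general_position U" for U
      by (rule step, erule (1) c0, rule chain_convex_diagonal_families) (use that in auto)
    have "colourable k V (strips snd \<union> strips fst \<union> strips ?d \<union> ?q 1 1 \<union> ?q (-1) (-1)) (?M + 2 * k + 2 * k)"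
      by (rule step, erule (1) c1, rule chain_convex_diagonal_families) (use V in auto)
    moreover have "?M + 2 * k + 2 * k = ?M + 4 * k" by simp
    ultimately obtain c where c: "\<forall>R\<in>strips snd \<union> strips fst \<union> strips ?d \<union> ?q 1 1 \<union> ?q (-1) (-1).
        ?M + 4 * k \<le> card (V \<inter> R) \<longrightarrow> {..<k} \<subseteq> c ` (V \<inter> R)"
      unfolding colourable_def by auto
    have "R_HS \<union> R_VS \<union> R_DS \<union> R_NW \<union> R_SE
        \<subseteq> strips snd \<union> strips fst \<union> strips ?d \<union> ?q 1 1 \<union> ?q (-1) (-1)"
      using range_families_quadrants unfolding range_families_strips by blast
    note sub = subsetD[OF this]
    show "\<exists>c. \<forall>R\<in>R_HS \<union> R_VS \<union> R_DS \<union> R_NW \<union> R_SE.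
        card (V \<inter> R) = ?M + 4 * k \<longrightarrow> {..<k} \<subseteq> c ` (V \<inter> R)"
    proof (intro exI[of _ c] ballI impI, goal_cases)
      case (1 R)
      then show ?case using bspec[OF c sub[OF 1(1)]] by simp
    qed
  qed
qed

end
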